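(* Let $q=p^e$ with $p$ an odd prime, $A=\mathbb{F}_q[T]$, and let $C$ be the Carlitz module. Let $m,u\in A$ be monic polynomials such that at least one of them has positive degree. Then there exists a Zsigmondy prime for $(u,m)$, except exactly in the following case: $q=3$, $u=1$, and $m=(\wp-1)\wp$, where $\wp$ is an arbitrary monic prime of degree $1$ in $\mathbb{F}_3[T]$.
   Context: $A=\mathbb{F}_q[T]$, $k=\mathbb{F}_q(T)$. The Carlitz module is the $\mathbb{F}_q$-algebra homomorphism $a\mapsto C_a$ from $A$ to the twisted polynomial ring $k\langle\tau\rangle$ (with $\tau(x)=x^q$) determined by $C_T=T+\tau$; thus $C_T(x)=Tx+x^q$ and for each $a\in A$, $C_a(x)\in A[x]$ is an $\mathbb{F}_q$-linear polynomial, with $C_{ab}(x)=C_a(C_b(x))$ and $C_{a+b}=C_a+C_b$. For nonzero $m,u\in A$, a Zsigmondy prime for $(u,m)$ is a monic prime $\wp\in A$ such that $C_m(u)\equiv 0\pmod{\wp}$ and $C_n(u)\not\equiv 0\pmod{\wp}$ for every nonzero $n\in A$ with $\deg(n)<\deg(m)$. *)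

theory Defs
  imports "HOL-Number_Theory.Number_Theory" "HOL-Computational_Algebra.Computational_Algebra"
    "HOL-Library.Cardinality"
begin

section \<open>Twisted polynomials\<close>

text \<open>
  A twisted polynomial \<open>\<Sum>i. c\<^sub>i \<tau>\<^sup>i\<close> over a commutative ring, with \<open>\<tau> x = x\<^sup>q \<tau>\<close>, is represented by
  the ordinary polynomial with the same coefficients. Addition is that of ordinary polynomials;
  the product is \<open>(a \<tau>\<^sup>i) (b \<tau>\<^sup>j) = a b\<^bsup>q\<^sup>i\<^esup> \<tau>\<^bsup>i + j\<^esup>\<close>, extended biadditively.
\<close>

definition tw_mult :: "nat \<Rightarrow> 'b::comm_ring_1 poly \<Rightarrow> 'b poly \<Rightarrow> 'b poly" where
  "tw_mult q f g =
     (\<Sum>i\<le>degree f. \<Sum>j\<le>degree g. monom (coeff f i * coeff g j ^ (q ^ i)) (i + j))"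

text \<open>The additive polynomial \<open>\<Sum>i. c\<^sub>i x\<^bsup>q\<^sup>i\<^esup>\<close> by which a twisted polynomial acts (\<open>\<tau> x = x\<^sup>q\<close>).\<close>

definition tw_to_poly :: "nat \<Rightarrow> 'b::comm_ring_1 poly \<Rightarrow> 'b poly" where
  "tw_to_poly q f = (\<Sum>i\<le>degree f. monom (coeff f i) (q ^ i))"


section \<open>The Carlitz module and Zsigmondy primes\<close>

text \<open>
  The finite field is the type \<open>'a\<close>, so that \<open>q = CARD('a)\<close>, \<open>A\<close> is the type \<open>'a poly\<close> and
  \<open>T\<close> is \<open>[:0, 1:]\<close>; the twisted polynomial \<open>T + \<tau>\<close> is \<open>[:[:0, 1:], 1:]\<close>. The value at
  \<open>a = \<Sum>i. a\<^sub>i T\<^sup>i\<close> is \<open>\<Sum>i. a\<^sub>i (T + \<tau>)\<^sup>i\<close>, with coefficients in \<open>A\<close>.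
  The lemmas \<open>carlitz_T\<close>, \<open>carlitz_const\<close>, \<open>carlitz_add\<close>, \<open>carlitz_mult\<close> and \<open>carlitz_unique\<close>
  below show that this is the only homomorphism of algebras over the finite field, from \<open>A\<close> to the
  twisted polynomials over the fraction field of \<open>A\<close>, that maps \<open>T\<close> to \<open>T + \<tau>\<close>.
\<close>

definition carlitz :: "'a::finite_field poly \<Rightarrow> 'a poly poly" where
  "carlitz a =
     (\<Sum>i\<le>degree a. smult [:coeff a i:] ((tw_mult CARD('a) [:[:0, 1:], 1:] ^^ i) 1))"

definition carlitz_poly :: "'a::finite_field poly \<Rightarrow> 'a poly poly" where
  "carlitz_poly a = tw_to_poly CARD('a) (carlitz a)"

definition zsigmondy_prime ::
    "'a::finite_field poly \<Rightarrow> 'a poly \<Rightarrow> 'a poly \<Rightarrow> bool" where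
  "zsigmondy_prime u m P \<longleftrightarrow>
     lead_coeff P = 1 \<and> prime_elem P \<and>
     [poly (carlitz_poly m) u = 0] (mod P) \<and>
     (\<forall>n. n \<noteq> 0 \<and> degree n < degree m \<longrightarrow> [poly (carlitz_poly n) u \<noteq> 0] (mod P))"


section \<open>Characterization of the Carlitz module\<close>

lemma poly_monom_add_induct:
  assumes "\<And>a n. P (monom a n)" "\<And>f g. P f \<Longrightarrow> P g \<Longrightarrow> P (f + g)"
  shows "P (f :: 'b::comm_ring_1 poly)"
proof -
  have "P (\<Sum>i\<in>I. monom (coeff f i) i)" if "finite I" for I
    using that by (induction I rule: finite_induct) (use assms(1)[of 0 0] assms in auto)
  from this[of "{..degree f}"] show ?thesis by (simp add: poly_as_sum_of_monoms)
qed

locale tw =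
  fixes q :: nat and T :: "'b::comm_ring_1 itself"
  assumes q_pos: "q > 0"
    and frob_add: "\<And>x y :: 'b. (x + y) ^ q = x ^ q + y ^ q"
begin

lemma frob_add_pow: "(x + y :: 'b) ^ (q ^ i) = x ^ (q ^ i) + y ^ (q ^ i)"
  by (induction i arbitrary: x y) (simp_all add: power_mult frob_add)

lemma frob_sum: "(\<Sum>i\<in>I. f i :: 'b) ^ (q ^ n) = (\<Sum>i\<in>I. f i ^ (q ^ n))"
  by (induction I rule: infinite_finite_induct) (simp_all add: frob_add_pow q_pos zero_power)

lemma tw_mult_bound:
  fixes f g :: "'b poly"
  assumes "degree f \<le> N" "degree g \<le> M"
  shows "tw_mult q f g = (\<Sum>i\<le>N. \<Sum>j\<le>M. monom (coeff f i * coeff g j ^ (q ^ i)) (i + j))"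
proof -
  have "(\<Sum>j\<le>degree g. monom (coeff f i * coeff g j ^ (q ^ i)) (i + j)) =
        (\<Sum>j\<le>M. monom (coeff f i * coeff g j ^ (q ^ i)) (i + j))" for i
    by (rule sum.mono_neutral_left)
       (use assms q_pos in \<open>auto simp: coeff_eq_0 zero_power not_le\<close>)
  then have "tw_mult q f g =
      (\<Sum>i\<le>degree f. \<Sum>j\<le>M. monom (coeff f i * coeff g j ^ (q ^ i)) (i + j))"
    by (simp add: tw_mult_def)
  also have "\<dots> = (\<Sum>i\<le>N. \<Sum>j\<le>M. monom (coeff f i * coeff g j ^ (q ^ i)) (i + j))"
    by (rule sum.mono_neutral_left) (use assms in \<open>auto simp: coeff_eq_0 not_le\<close>)
  finally show ?thesis .
qed

lemma tw_mult_add_left: "tw_mult q (f + g) h = tw_mult q f h + tw_mult q g (h :: 'b poly)"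
proof -
  define N where "N = max (degree f) (degree g)"
  have "degree f \<le> N" "degree g \<le> N" "degree (f + g) \<le> N"
    unfolding N_def by (auto intro: degree_add_le)
  then show ?thesis
    by (simp add: tw_mult_bound[where N = N and M = "degree h"] algebra_simps
        flip: add_monom sum.distrib)
qed

lemma tw_mult_add_right: "tw_mult q h (f + g) = tw_mult q h f + tw_mult q h (g :: 'b poly)"
proof -
  define N where "N = max (degree f) (degree g)"
  have "degree f \<le> N" "degree g \<le> N" "degree (f + g) \<le> N"
    unfolding N_def by (auto intro: degree_add_le)
  then show ?thesis
    by (simp add: tw_mult_bound[where M = N and N = "degree h"] algebra_simps frob_add_pow
        flip: add_monom sum.distrib)
qed

lemma tw_mult_0 [simp]: "tw_mult q 0 g = 0" "tw_mult q g (0 :: 'b poly) = 0"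
  by (simp_all add: tw_mult_def q_pos zero_power)

lemma tw_mult_monom:
  "tw_mult q (monom a i) (monom b j) = monom (a * b ^ (q ^ i)) (i + j)" for a b :: 'b
proof -
  have "tw_mult q (monom a i) (monom b j) = (\<Sum>k\<le>i. \<Sum>l\<le>j.
      monom ((if i = k then a else 0) * (if j = l then b else 0) ^ (q ^ k)) (k + l))"
    using tw_mult_bound[of "monom a i" i "monom b j" j] by (simp add: degree_monom_le)
  also have "\<dots> = (\<Sum>k\<le>i. \<Sum>l\<le>j.
      if l = j then (if k = i then monom (a * b ^ (q ^ i)) (i + j) else 0) else 0)"
    by (intro sum.cong) (use q_pos in \<open>auto simp: zero_power\<close>)
  also have "\<dots> = monom (a * b ^ (q ^ i)) (i + j)"
    by simp
  finally show ?thesis .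
qed

lemma tw_mult_assoc:
  "tw_mult q (tw_mult q f g) h = tw_mult q f (tw_mult q g (h :: 'b poly))"
proof (induction f rule: poly_monom_add_induct)
  case (1 a i)
  show ?case
  proof (induction g rule: poly_monom_add_induct)
    case (1 b j)
    show ?case
    proof (induction h rule: poly_monom_add_induct)
      case (1 c l)
      show ?case
        by (simp add: tw_mult_monom power_mult_distrib power_add mult_ac add_ac flip: power_mult)
    qed (simp add: tw_mult_add_right)
  qed (simp add: tw_mult_add_right tw_mult_add_left)
qed (simp add: tw_mult_add_left)

lemma tw_mult_const_left: "tw_mult q [:c:] g = smult c (g :: 'b poly)"
proof (induction g rule: poly_monom_add_induct)
  case (1 a n)
  show ?case using tw_mult_monom[of c 0 a n] by (simp add: monom_0 smult_monom)
qed (simp add: tw_mult_add_right smult_add_right)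

lemma tw_mult_const_right: "tw_mult q g 1 = (g :: 'b poly)"
proof (induction g rule: poly_monom_add_induct)
  case (1 a n)
  show ?case using tw_mult_monom[of a n 1 0] by simp
qed (simp add: tw_mult_add_left)

lemma tw_to_poly_bound:
  "degree f \<le> N \<Longrightarrow> tw_to_poly q f = (\<Sum>i\<le>N. monom (coeff (f :: 'b poly) i) (q ^ i))"
  unfolding tw_to_poly_def
  by (rule sum.mono_neutral_left) (auto simp: coeff_eq_0 not_le)

lemma tw_to_poly_add: "tw_to_poly q (f + g) = tw_to_poly q f + tw_to_poly q (g :: 'b poly)"
proof -
  define N where "N = max (degree f) (degree g)"
  have "degree f \<le> N" "degree g \<le> N" "degree (f + g) \<le> N"
    unfolding N_def by (auto intro: degree_add_le)
  then show ?thesis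
    by (simp add: tw_to_poly_bound[where N = N] flip: add_monom sum.distrib)
qed

lemma tw_to_poly_monom: "tw_to_poly q (monom a i) = monom (a :: 'b) (q ^ i)"
proof -
  have "tw_to_poly q (monom a i) = (\<Sum>k\<le>i. if k = i then monom a (q ^ i) else 0)"
    unfolding tw_to_poly_bound[OF degree_monom_le] by (intro sum.cong) auto
  then show ?thesis by simp
qed

lemma poly_tw_to_poly_add:
  "poly (tw_to_poly q f) (x + y) = poly (tw_to_poly q f) x + poly (tw_to_poly q f) (y :: 'b)"
  by (induction f rule: poly_monom_add_induct)
     (simp_all add: tw_to_poly_monom tw_to_poly_add poly_monom frob_add_pow algebra_simps)

lemma poly_tw_to_poly_mult:
  "poly (tw_to_poly q (tw_mult q f g)) x = poly (tw_to_poly q f) (poly (tw_to_poly q g) (x :: 'b))"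
proof (induction f rule: poly_monom_add_induct)
  case (1 a i)
  show ?case
  proof (induction g rule: poly_monom_add_induct)
    case (1 b j)
    show ?case
      by (simp add: tw_mult_monom tw_to_poly_monom poly_monom power_mult_distrib power_add mult_ac
          flip: power_mult)
  qed (simp add: tw_mult_add_right tw_to_poly_add poly_tw_to_poly_add)
qed (simp add: tw_mult_add_left tw_to_poly_add)

end

lemma CARD_power_CHAR:
  assumes "prime p" "CARD('a::finite_field) = p ^ e"
  shows "CHAR('a) = p"
proof -
  have "prime CHAR('a)" by simp
  moreover have "CHAR('a) dvd p ^ e" using CHAR_dvd_CARD[where 'a = 'a] assms(2) by simp
  ultimately show ?thesis
    using assms(1) by (meson prime_dvd_power primes_dvd_imp_eq)
qed

context
  fixes p e :: nat and X :: "'a::finite_field itself"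
  assumes p: "prime p" and card: "CARD('a) = p ^ e"
begin

lemma tw_poly: "tw TYPE('a poly) CARD('a)"
proof
  show "CARD('a) > 0" by simp
  show "(x + y) ^ CARD('a) = x ^ CARD('a) + y ^ CARD('a)" for x y :: "'a poly"
    by (rule freshmans_dream'[where n = e]) (use CARD_power_CHAR[OF p card] p card in auto)
qed

lemma tw_fract: "tw TYPE('a poly fract) CARD('a)"
proof
  show "CARD('a) > 0" by simp
  have hom: "to_fract (z ^ n) = to_fract z ^ n" for z :: "'a poly" and n
    by (induction n) simp_all
  interpret A: tw "CARD('a)" "TYPE('a poly)" by (rule tw_poly)
  show "(x + y) ^ CARD('a) = x ^ CARD('a) + y ^ CARD('a)" for x y :: "'a poly fract"
  proof -
    obtain a b where x: "x = to_fract a / to_fract b" "b \<noteq> 0"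
      by (cases x) (auto simp: Fract_conv_to_fract)
    obtain c d where y: "y = to_fract c / to_fract d" "d \<noteq> 0"
      by (cases y) (auto simp: Fract_conv_to_fract)
    have "x + y = to_fract (a * d + c * b) / to_fract (b * d)"
      using x y by (simp add: field_simps)
    then have "(x + y) ^ CARD('a) =
        to_fract ((a * d) ^ CARD('a) + (c * b) ^ CARD('a)) / to_fract ((b * d) ^ CARD('a))"
      by (simp only: power_divide A.frob_add flip: hom)
    also have "\<dots> = x ^ CARD('a) + y ^ CARD('a)"
      unfolding x(1) y(1)
      using x(2) y(2) by (simp add: hom power_divide power_mult_distrib add_frac_eq)
    finally show ?thesis .
  qed
qed

interpretation A: tw "CARD('a)" "TYPE('a poly)" by (rule tw_poly)
interpretation K: tw "CARD('a)" "TYPE('a poly fract)" by (rule tw_fract)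

lemma carlitz_bound:
  "degree a \<le> N \<Longrightarrow> carlitz (a :: 'a poly) =
     (\<Sum>i\<le>N. smult [:coeff a i:] ((tw_mult CARD('a) [:[:0, 1:], 1:] ^^ i) 1))"
  unfolding carlitz_def
  by (rule sum.mono_neutral_left) (auto simp: coeff_eq_0 not_le)

lemma carlitz_add: "carlitz (a + b) = carlitz a + carlitz (b :: 'a poly)"
proof -
  define N where "N = max (degree a) (degree b)"
  have "degree a \<le> N" "degree b \<le> N" "degree (a + b) \<le> N"
    unfolding N_def by (auto intro: degree_add_le)
  moreover have "[:x + y:] = [:x:] + [:y:]" for x y :: 'a by simp
  ultimately show ?thesis
    by (simp add: carlitz_bound[where N = N] smult_add_left sum.distrib del: add_pCons)
qed

lemma smult_sum_right: "smult c (\<Sum>i\<in>I. f i) = (\<Sum>i\<in>I. smult c (f i :: 'a poly poly))"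
  by (induction I rule: infinite_finite_induct) (simp_all add: smult_add_right)

lemma carlitz_smult: "carlitz (smult c a) = smult [:c:] (carlitz (a :: 'a poly))"
proof -
  have "degree (smult c a) \<le> degree a" by (rule degree_smult_le)
  then have "carlitz (smult c a) = (\<Sum>i\<le>degree a. smult [:coeff (smult c a) i:]
      ((tw_mult CARD('a) [:[:0, 1:], 1:] ^^ i) 1))"
    by (rule carlitz_bound)
  also have "\<dots> = smult [:c:] (carlitz a)"
    by (simp add: carlitz_def smult_sum_right mult.commute)
  finally show ?thesis .
qed

lemma carlitz_const: "carlitz [:c:] = [:[:c :: 'a:]:]"
  by (simp add: carlitz_def)

lemma carlitz_T: "carlitz [:0, 1 :: 'a:] = [:[:0, 1:], 1:]"
  by (simp add: carlitz_def A.tw_mult_const_right)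

lemma tw_mult_smult_const:
  "tw_mult CARD('a) f (smult [:c :: 'a:] g) = smult [:c:] (tw_mult CARD('a) f g)"
proof (induction f rule: poly_monom_add_induct)
  case (1 a i)
  have c: "[:c:] ^ (CARD('a) ^ i) = [:c:]"
    using finite_field_power_card_power_eq_same[of "CARD('a) ^ i" i c]
    by (metis poly_const_pow)
  show ?case
  proof (induction g rule: poly_monom_add_induct)
    case (1 b j)
    have "tw_mult CARD('a) (monom a i) (smult [:c:] (monom b j)) =
        monom (a * ([:c:] * b) ^ (CARD('a) ^ i)) (i + j)"
      by (simp only: smult_monom A.tw_mult_monom)
    also have "\<dots> = smult [:c:] (tw_mult CARD('a) (monom a i) (monom b j))"
      by (simp only: smult_monom A.tw_mult_monom power_mult_distrib c mult_ac)
    finally show ?case .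
  qed (simp only: smult_add_right A.tw_mult_add_right)
qed (simp only: smult_add_right A.tw_mult_add_left)

lemma tw_mult_sum_right:
  "tw_mult CARD('a) f (\<Sum>i\<in>I. g i) = (\<Sum>i\<in>I. tw_mult CARD('a) f (g i :: 'a poly poly))"
  by (induction I rule: infinite_finite_induct) (simp_all add: A.tw_mult_add_right)

lemma carlitz_pCons:
  "carlitz (pCons c a) = [:[:c:]:] + tw_mult CARD('a) [:[:0, 1:], 1:] (carlitz (a :: 'a poly))"
proof -
  have "carlitz (pCons c a) = (\<Sum>i\<le>Suc (degree a). smult [:coeff (pCons c a) i:]
      ((tw_mult CARD('a) [:[:0, 1:], 1:] ^^ i) 1))"
    by (rule carlitz_bound) (rule degree_pCons_le)
  also have "\<dots> = [:[:c:]:] + tw_mult CARD('a) [:[:0, 1:], 1:] (carlitz a)"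
    by (subst sum.atMost_Suc_shift)
       (simp add: carlitz_def tw_mult_sum_right tw_mult_smult_const)
  finally show ?thesis .
qed

lemma carlitz_mult: "carlitz (a * b) = tw_mult CARD('a) (carlitz a) (carlitz (b :: 'a poly))"
proof (induction a)
  case 0
  show ?case by (simp add: carlitz_def)
next
  case (pCons c a)
  have "carlitz (pCons c a * b) = carlitz (smult c b) + carlitz (pCons 0 (a * b))"
    by (simp only: mult_pCons_left carlitz_add)
  also have "\<dots> = smult [:c:] (carlitz b) +
      tw_mult CARD('a) [:[:0, 1:], 1:] (tw_mult CARD('a) (carlitz a) (carlitz b))"
    by (simp add: carlitz_smult carlitz_pCons pCons.IH)
  also have "\<dots> = tw_mult CARD('a) (carlitz (pCons c a)) (carlitz b)"
    by (simp add: carlitz_pCons A.tw_mult_add_left A.tw_mult_assoc A.tw_mult_const_left)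
  finally show ?case .
qed

lemma fract_poly_add: "fract_poly (f + g) = fract_poly f + fract_poly (g :: 'a poly poly)"
  by (rule poly_eqI) (simp add: coeff_map_poly)

lemma fract_poly_tw_mult:
  "fract_poly (tw_mult CARD('a) f g) =
     tw_mult CARD('a) (fract_poly f) (fract_poly (g :: 'a poly poly))"
proof (induction f rule: poly_monom_add_induct)
  case (1 a i)
  have hom: "to_fract (z ^ n) = to_fract z ^ n" for z :: "'a poly" and n
    by (induction n) simp_all
  show ?case
  proof (induction g rule: poly_monom_add_induct)
    case (1 b j)
    show ?case by (simp add: A.tw_mult_monom K.tw_mult_monom map_poly_monom hom)
  qed (simp only: A.tw_mult_add_right K.tw_mult_add_right fract_poly_add)
qed (simp only: A.tw_mult_add_left K.tw_mult_add_left fract_poly_add)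

lemma carlitz_unique:
  fixes \<phi> :: "'a poly \<Rightarrow> 'a poly fract poly"
  assumes add: "\<And>a b. \<phi> (a + b) = \<phi> a + \<phi> b"
    and mult: "\<And>a b. \<phi> (a * b) = tw_mult CARD('a) (\<phi> a) (\<phi> b)"
    and const: "\<And>c. \<phi> [:c:] = [:to_fract [:c:]:]"
    and T: "\<phi> [:0, 1:] = [:to_fract [:0, 1:], 1:]"
  shows "\<phi> a = fract_poly (carlitz a)"
proof (induction a)
  case 0
  show ?case using const[of 0] by (simp add: carlitz_def)
next
  case (pCons c a)
  have "\<phi> (pCons c a) = \<phi> ([:c:] + [:0, 1:] * a)" by simp
  also have "\<dots> = [:to_fract [:c:]:] +
      tw_mult CARD('a) [:to_fract [:0, 1:], 1:] (fract_poly (carlitz a))"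
    by (simp only: add mult const T pCons.IH)
  also have "\<dots> = fract_poly (carlitz (pCons c a))"
    by (simp add: carlitz_pCons fract_poly_add fract_poly_tw_mult map_poly_pCons)
  finally show ?case .
qed

lemma poly_carlitz_poly_T: "poly (carlitz_poly [:0, 1 :: 'a:]) x = [:0, 1:] * x + x ^ CARD('a)"
  unfolding carlitz_poly_def carlitz_T by (simp add: tw_to_poly_def poly_monom)

lemma poly_carlitz_poly_add:
  "poly (carlitz_poly (a + b)) x = poly (carlitz_poly a) x + poly (carlitz_poly b) (x :: 'a poly)"
  by (simp add: carlitz_poly_def carlitz_add A.tw_to_poly_add)

lemma poly_carlitz_poly_mult:
  "poly (carlitz_poly (a * b)) x = poly (carlitz_poly a) (poly (carlitz_poly b) (x :: 'a poly))"
  by (simp add: carlitz_poly_def carlitz_mult A.poly_tw_to_poly_mult)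

end

end

theory Submission
  imports Defs
begin

text \<open>
  Let \<open>S\<close> be the set of monic primes dividing \<open>m\<close> and, for \<open>D \<subseteq> S\<close>, let \<open>m\<^sub>D = m / \<Prod>D\<close>. The alternating
  sum over \<open>D\<close> of the degrees of \<open>C\<^bsub>m\<^sub>D\<^esub>(u)\<close> is the degree of the Carlitz analogue of the value at \<open>u\<close>
  of the \<open>m\<close>-th cyclotomic polynomial: it is \<open>\<phi>(m) deg u\<close> if \<open>deg u > 0\<close>, and \<open>(\<phi>(m) - \<mu>(m)) / q\<close> if
  \<open>u = 1\<close>. It is also a sum over primes \<open>P\<close> of \<open>deg P\<close> times an alternating sum of valuations. Since
  \<open>C\<^sub>b(x) = x (b + x\<^sup>2 h)\<close>, the valuation at \<open>P\<close> of \<open>C\<^bsub>m\<^sub>D\<^esub>(u)\<close> depends on \<open>D\<close> only through whether \<open>P \<in> D\<close>,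
  as long as it is positive. Hence, if there is no Zsigmondy prime, the contribution of \<open>P\<close> is \<open>deg P\<close>
  when \<open>P\<close> is the only \<open>l \<in> S\<close> such that \<open>P\<close> divides \<open>C\<^bsub>m/l\<^esub>(u)\<close>, and zero otherwise. By the pigeonhole
  principle the annihilator of \<open>u\<close> modulo \<open>P\<close> has degree at most \<open>deg P\<close>, so such an extremal prime is
  unique unless \<open>m\<close> is a product of two primes of the same degree. The size of \<open>\<phi>(m)\<close> then leaves only
  \<open>q = 3\<close>, \<open>u = 1\<close> and \<open>m\<close> a product of two distinct monic linear polynomials, which differ by 1.
\<close>

section \<open>Valuations of polynomials over a field\<close>

lemma monic_prime_dvd_eq:
  fixes P Q :: "'a::field poly"
  assumes "prime_elem P" "prime_elem Q" "lead_coeff P = 1" "lead_coeff Q = 1" "P dvd Q"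
  shows "P = Q"
proof -
  from assms(5) obtain c where c: "Q = P * c" by auto
  have "irreducible Q" using assms(2) by (rule prime_elem_imp_irreducible)
  then have "is_unit c" using c assms(1) by (auto dest: irreducibleD)
  then obtain a where a: "c = [:a:]" by (auto elim: is_unit_polyE)
  then have Q: "Q = smult a P" using c by simp
  then have "a = 1" using assms(3,4) by (simp only: lead_coeff_smult mult_1_right)
  then show ?thesis using Q by simp
qed

lemma prime_elem_poly_degree_pos:
  fixes P :: "'a::field poly"
  assumes "prime_elem P"
  shows "degree P > 0"
  using assms by (metis is_unit_iff_degree not_gr_zero prime_elem_def)

lemma monic_prime_divisor_exists:
  fixes x :: "'a::field poly"
  assumes "x \<noteq> 0" "degree x > 0"
  obtains P where "prime_elem P" "lead_coeff P = 1" "P dvd x"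
  using assms
proof (induction "degree x" arbitrary: x thesis rule: less_induct)
  case less
  show ?case
  proof (cases "irreducible x")
    case True
    define P where "P = smult (inverse (lead_coeff x)) x"
    have "P = [:inverse (lead_coeff x):] * x" "is_unit [:inverse (lead_coeff x):]"
      unfolding P_def using less.prems by (simp_all add: is_unit_pCons_iff)
    then have "irreducible P" using True irreducible_mult_unit_left by metis
    then have "prime_elem P" by (rule field_poly_irreducible_imp_prime)
    moreover have "lead_coeff P = 1" "P dvd x"
      unfolding P_def using less.prems by (simp_all add: smult_dvd_iff)
    ultimately show ?thesis using less.prems by blast
  next
    case False
    have "\<not> is_unit x" using less.prems by (simp add: is_unit_iff_degree)
    then obtain a b where ab: "x = a * b" "\<not> is_unit a" "\<not> is_unit b"
      using False less.prems by (auto simp: irreducible_def)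
    then have "a \<noteq> 0" "b \<noteq> 0" using less.prems by auto
    moreover from this ab have "degree a > 0" "degree b > 0"
      by (simp_all add: is_unit_iff_degree)
    ultimately obtain P where "prime_elem P" "lead_coeff P = 1" "P dvd a"
      using less.hyps[of a] ab(1) by (auto simp: degree_mult_eq)
    then show ?thesis using less.prems ab(1) by auto
  qed
qed

lemma prime_elem_dvd_prodE:
  assumes "prime_elem P" "finite S" "P dvd prod f S"
  obtains x where "x \<in> S" "P dvd f x"
  using assms(2,3)
proof (induction S arbitrary: thesis rule: finite_induct)
  case empty
  then show ?case using assms(1) by (simp add: prime_elem_def)
next
  case (insert y S)
  then show ?case using assms(1) by (auto simp: prime_elem_dvd_mult_iff)
qed

lemma prime_dvd_prod_monic_primes_iff:
  fixes P :: "'a::field poly"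
  assumes "finite D" "\<And>l. l \<in> D \<Longrightarrow> prime_elem l \<and> lead_coeff l = 1"
    "prime_elem P" "lead_coeff P = 1"
  shows "P dvd \<Prod>D \<longleftrightarrow> P \<in> D"
proof
  assume "P dvd \<Prod>D"
  then obtain l where "l \<in> D" "P dvd l"
    using prime_elem_dvd_prodE[of P D "\<lambda>x. x"] assms by auto
  then show "P \<in> D" using assms monic_prime_dvd_eq by metis
next
  assume "P \<in> D"
  then show "P dvd \<Prod>D" using assms(1) by (metis dvd_triv_left prod.remove)
qed

lemma prod_monic_primes_dvd:
  fixes t :: "'a::field poly"
  assumes "finite D" "\<And>l. l \<in> D \<Longrightarrow> prime_elem l \<and> lead_coeff l = 1 \<and> l dvd t"
  shows "\<Prod>D dvd t"
  using assms
proof (induction D rule: finite_induct)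
  case (insert l D)
  then obtain s where s: "t = \<Prod>D * s" by (metis dvd_def insertCI)
  have "\<not> l dvd \<Prod>D"
    using prime_dvd_prod_monic_primes_iff[of D l] insert by auto
  then have "l dvd s" using insert.prems[of l] s by (auto simp: prime_elem_dvd_mult_iff)
  then show ?case using s insert.hyps by (auto simp: mult.commute mult.left_commute)
qed simp

lemma not_square_dvd_prod_monic_primes:
  fixes P :: "'a::field poly"
  assumes "finite D" "\<And>l. l \<in> D \<Longrightarrow> prime_elem l \<and> lead_coeff l = 1"
    "prime_elem P" "lead_coeff P = 1"
  shows "\<not> P ^ 2 dvd \<Prod>D"
proof
  assume sq: "P ^ 2 dvd \<Prod>D"
  then have "P dvd \<Prod>D" by (metis dvd_trans dvd_triv_left power2_eq_square)
  then have "P \<in> D" using prime_dvd_prod_monic_primes_iff assms by blast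
  then have "\<Prod>D = P * \<Prod>(D - {P})" using assms(1) by (simp add: prod.remove)
  then have "P dvd \<Prod>(D - {P})" using sq assms(3) by (simp add: power2_eq_square)
  then show False using prime_dvd_prod_monic_primes_iff[of "D - {P}" P] assms by auto
qed

lemma monic_linearE:
  assumes "lead_coeff Q = 1" "degree Q = 1"
  obtains c where "Q = [:c, 1:]"
proof -
  obtain a b where Q: "Q = [:b, a:]" "a \<noteq> 0" using assms(2) degree1_coeffs by blast
  then show ?thesis using assms(1) that by simp
qed

text \<open>
  The library's \<open>multiplicity\<close> is not available here, because polynomials over an arbitrary
  (finite) field are not an instance of \<open>factorial_semiring\<close>.
\<close>

definition poly_val :: "'a::field poly \<Rightarrow> 'a poly \<Rightarrow> nat" where
  "poly_val P x = (GREATEST n. P ^ n dvd x)"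

lemma poly_val_eqI:
  assumes "prime_elem P" "\<not> P dvd y"
  shows "poly_val P (P ^ n * y) = n"
  unfolding poly_val_def
proof (rule Greatest_equality)
  fix k assume k: "P ^ k dvd P ^ n * y"
  show "k \<le> n"
  proof (rule ccontr)
    assume "\<not> k \<le> n"
    then have "P ^ Suc n dvd P ^ n * y" using k by (meson dvd_trans le_imp_power_dvd not_less_eq_eq)
    then have "P ^ n * P dvd P ^ n * y" by (simp add: mult.commute)
    then show False using assms by (auto simp: prime_elem_def)
  qed
qed simp

lemma poly_val_decomp:
  assumes "prime_elem P" "x \<noteq> 0"
  obtains y where "x = P ^ poly_val P x * y" "\<not> P dvd y"
proof -
  have "\<exists>n y. x = P ^ n * y \<and> \<not> P dvd y"
    using assms(2)
  proof (induction "degree x" arbitrary: x rule: less_induct)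
    case less
    show ?case
    proof (cases "P dvd x")
      case True
      then obtain z where z: "x = P * z" by auto
      then have "z \<noteq> 0" "P \<noteq> 0" using less.prems by auto
      then have "degree z < degree x"
        using z prime_elem_poly_degree_pos[OF assms(1)] by (simp add: degree_mult_eq)
      then obtain n y where "z = P ^ n * y" "\<not> P dvd y" using less.hyps \<open>z \<noteq> 0\<close> by blast
      then have "x = P ^ Suc n * y" using z by (simp add: mult.assoc)
      then show ?thesis using \<open>\<not> P dvd y\<close> by blast
    next
      case False
      then show ?thesis by (intro exI[of _ 0] exI[of _ x]) simp
    qed
  qed
  then show ?thesis using that poly_val_eqI[OF assms(1)] by metis
qed

lemma poly_val_mult:
  assumes "prime_elem P" "x \<noteq> 0" "y \<noteq> 0"
  shows "poly_val P (x * y) = poly_val P x + poly_val P y"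
proof -
  obtain x' y' where x': "x = P ^ poly_val P x * x'" "\<not> P dvd x'"
    and y': "y = P ^ poly_val P y * y'" "\<not> P dvd y'"
    using poly_val_decomp assms by metis
  have "x * y = P ^ (poly_val P x + poly_val P y) * (x' * y')"
    by (subst (1) x'(1), subst (1) y'(1)) (simp add: power_add mult_ac)
  moreover have "\<not> P dvd x' * y'" using x' y' assms(1) by (simp add: prime_elem_dvd_mult_iff)
  ultimately show ?thesis using poly_val_eqI[OF assms(1)] by metis
qed

lemma poly_val_eq_0: "prime_elem P \<Longrightarrow> \<not> P dvd x \<Longrightarrow> poly_val P x = 0"
  using poly_val_eqI[of P x 0] by simp

lemma degree_eq_sum_poly_val:
  fixes x :: "'a::field poly"
  assumes "x \<noteq> 0" "finite I" "\<And>P. P \<in> I \<Longrightarrow> prime_elem P \<and> lead_coeff P = 1"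
    "\<And>P. prime_elem P \<Longrightarrow> lead_coeff P = 1 \<Longrightarrow> P dvd x \<Longrightarrow> P \<in> I"
  shows "degree x = (\<Sum>P\<in>I. poly_val P x * degree P)"
  using assms(1,4)
proof (induction "degree x" arbitrary: x rule: less_induct)
  case less
  show ?case
  proof (cases "degree x = 0")
    case True
    then have "is_unit x" using less.prems by (simp add: is_unit_iff_degree)
    then have "\<not> P dvd x" if "P \<in> I" for P
      using assms(3)[OF that] by (meson dvd_trans prime_elem_def)
    then show ?thesis using True assms(3) by (simp add: poly_val_eq_0)
  next
    case False
    then obtain Q where Q: "prime_elem Q" "lead_coeff Q = 1" "Q dvd x"
      using monic_prime_divisor_exists less.prems(1) by blast
    then obtain y where y: "x = Q * y" by auto
    then have nz: "y \<noteq> 0" "Q \<noteq> 0" using less.prems by auto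
    then have deg: "degree x = degree Q + degree y" using y by (simp add: degree_mult_eq)
    have QI: "Q \<in> I" using less.prems(2) Q by blast
    have "degree y = (\<Sum>P\<in>I. poly_val P y * degree P)"
      by (rule less.hyps) (use deg prime_elem_poly_degree_pos[OF Q(1)] nz less.prems(2) y in auto)
    moreover have "degree Q = (\<Sum>P\<in>I. poly_val P Q * degree P)"
    proof -
      have "poly_val P Q = (if P = Q then 1 else 0)" if "P \<in> I" for P
      proof (cases "P = Q")
        case True
        then show ?thesis using poly_val_eqI[of Q 1 1] Q(1) by (simp add: prime_elem_def)
      next
        case False
        then show ?thesis using monic_prime_dvd_eq[of P Q] assms(3)[OF that] Q
          by (auto intro: poly_val_eq_0)
      qed
      then have "(\<Sum>P\<in>I. poly_val P Q * degree P) = (\<Sum>P\<in>I. if P = Q then degree Q else 0)"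
        by (intro sum.cong) auto
      then show ?thesis using assms(2) QI by simp
    qed
    ultimately have "degree x = (\<Sum>P\<in>I. (poly_val P Q + poly_val P y) * degree P)"
      using deg by (simp add: algebra_simps sum.distrib)
    also have "\<dots> = (\<Sum>P\<in>I. poly_val P x * degree P)"
      by (rule sum.cong) (use poly_val_mult[OF _ nz(2,1)] assms(3) y in auto)
    finally show ?thesis .
  qed
qed

definition monic_prime_divisors :: "'a::field poly \<Rightarrow> 'a poly set" where
  "monic_prime_divisors x = {P. prime_elem P \<and> lead_coeff P = 1 \<and> P dvd x}"

lemma div_prod_mult:
  assumes "finite (monic_prime_divisors m)" "D \<subseteq> monic_prime_divisors m"
  shows "m div \<Prod>D * \<Prod>D = m"
proof -
  have "finite D" using assms finite_subset by blast
  then have "\<Prod>D dvd m"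
    by (rule prod_monic_primes_dvd) (use assms(2) in \<open>auto simp: monic_prime_divisors_def\<close>)
  then show ?thesis by simp
qed

lemma div_prime_mult: "l \<in> monic_prime_divisors m \<Longrightarrow> m div l * l = m"
  by (simp add: monic_prime_divisors_def)

lemma dvd_div_prod_iff:
  fixes n m :: "'a::field poly"
  assumes "m \<noteq> 0" "finite (monic_prime_divisors m)" "D \<subseteq> monic_prime_divisors m"
  shows "n dvd m div \<Prod>D \<longleftrightarrow> n dvd m \<and> (\<forall>l\<in>D. n dvd m div l)"
proof
  assume n: "n dvd m div \<Prod>D"
  have "n dvd m div l" if "l \<in> D" for l
  proof -
    have "finite D" using assms finite_subset by blast
    then have "\<Prod>D = \<Prod>(D - {l}) * l" using that by (simp add: prod.remove mult.commute)
    then have m: "m div \<Prod>D * \<Prod>(D - {l}) * l = m"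
      using div_prod_mult[OF assms(2,3)] by (simp add: mult.assoc)
    then have "l \<noteq> 0" using assms(1) by auto
    then have "m div l = m div \<Prod>D * \<Prod>(D - {l})"
      using m nonzero_mult_div_cancel_right[of l "m div \<Prod>D * \<Prod>(D - {l})"] by simp
    then show ?thesis using n by simp
  qed
  then show "n dvd m \<and> (\<forall>l\<in>D. n dvd m div l)"
    using n dvd_mult2[OF n, of "\<Prod>D"] div_prod_mult[OF assms(2,3)] by simp
next
  assume *: "n dvd m \<and> (\<forall>l\<in>D. n dvd m div l)"
  then obtain t where t: "m = n * t" by auto
  have nz: "n \<noteq> 0" "t \<noteq> 0" using t assms(1) by auto
  have "l dvd t" if "l \<in> D" for l
  proof -
    obtain s where "m div l = n * s" using * \<open>l \<in> D\<close> by auto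
    then have "n * t = n * (s * l)" using div_prime_mult[of l m] \<open>l \<in> D\<close> assms(3) t
      by (auto simp: mult.assoc)
    then show ?thesis using nz by simp
  qed
  then have "\<Prod>D dvd t"
    using assms(2,3) finite_subset
    by (intro prod_monic_primes_dvd) (auto simp: monic_prime_divisors_def)
  then obtain r where r: "t = r * \<Prod>D" by (metis dvd_def mult.commute)
  then have "m div \<Prod>D * \<Prod>D = n * r * \<Prod>D" using div_prod_mult[OF assms(2,3)] t by (simp add: mult.assoc)
  then show "n dvd m div \<Prod>D" using r nz by auto
qed

lemma degree_div_prod:
  assumes "m \<noteq> 0" "finite (monic_prime_divisors m)" "D \<subseteq> monic_prime_divisors m"
  defines "S \<equiv> monic_prime_divisors m"
  shows "degree (m div \<Prod>D) = degree (m div \<Prod>S) + (\<Sum>l\<in>S - D. degree l)"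
proof -
  have "\<Prod>S = \<Prod>(S - D) * \<Prod>D" using assms by (simp add: prod.subset_diff)
  then have "m div \<Prod>S * \<Prod>(S - D) * \<Prod>D = m div \<Prod>D * \<Prod>D"
    using div_prod_mult[OF assms(2,3)] div_prod_mult[OF assms(2) order_refl]
    by (simp add: S_def mult.assoc)
  moreover have nz: "m div \<Prod>D \<noteq> 0" "\<Prod>D \<noteq> 0"
    using div_prod_mult[OF assms(2,3)] assms(1) by auto
  ultimately have eq: "m div \<Prod>S * \<Prod>(S - D) = m div \<Prod>D" by simp
  then have "degree (m div \<Prod>D) = degree (m div \<Prod>S) + degree (\<Prod>(S - D))"
    using nz by (metis degree_mult_eq mult_eq_0_iff)
  moreover have "degree (\<Prod>(S - D)) = (\<Sum>l\<in>S - D. degree l)"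
    by (rule degree_prod_eq_sum_degree) (auto simp: S_def monic_prime_divisors_def)
  ultimately show ?thesis by simp
qed

section \<open>Finite sets of polynomials and alternating sums\<close>

lemma card_poly_degree_less:
  "finite {a :: 'a::finite_field poly. \<forall>i\<ge>n. coeff a i = 0} \<and>
   card {a :: 'a poly. \<forall>i\<ge>n. coeff a i = 0} = CARD('a) ^ n"
proof (induction n)
  case 0
  have "{a :: 'a poly. \<forall>i\<ge>0. coeff a i = 0} = {0}" by (auto simp: poly_eq_iff)
  then show ?case by simp
next
  case (Suc n)
  let ?B = "\<lambda>n. {a :: 'a poly. \<forall>i\<ge>n. coeff a i = 0}"
  have eq: "?B (Suc n) = (\<lambda>(c, a). pCons c a) ` (UNIV \<times> ?B n)"
  proof (intro equalityI subsetI)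
    fix b assume b: "b \<in> ?B (Suc n)"
    obtain c a where ca: "b = pCons c a" by (cases b)
    have "a \<in> ?B n" using b unfolding ca by (auto simp: coeff_pCons split: nat.splits)
    then show "b \<in> (\<lambda>(c, a). pCons c a) ` (UNIV \<times> ?B n)" using ca by auto
  next
    fix b assume "b \<in> (\<lambda>(c, a). pCons c a) ` (UNIV \<times> ?B n)"
    then show "b \<in> ?B (Suc n)" by (auto simp: coeff_pCons split: nat.splits)
  qed
  have inj: "inj_on (\<lambda>(c, a). pCons c a) (UNIV \<times> ?B n)" by (auto simp: inj_on_def)
  show ?case unfolding eq using Suc inj by (simp add: card_image card_cartesian_product)
qed

lemma finite_poly_degree_le: "finite {a :: 'a::finite_field poly. degree a \<le> n}"
  by (rule finite_subset[OF _ conjunct1[OF card_poly_degree_less[of "Suc n"]]])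
     (auto simp: coeff_eq_0)

lemma finite_monic_prime_divisors:
  fixes x :: "'a::finite_field poly"
  assumes "x \<noteq> 0"
  shows "finite (monic_prime_divisors x)"
  unfolding monic_prime_divisors_def
  by (rule finite_subset[OF _ finite_poly_degree_le[of "degree x"]])
     (use assms in \<open>auto intro: dvd_imp_degree_le\<close>)

lemma alternating_sum_Pow_eq_0:
  fixes f :: "'b set \<Rightarrow> int"
  assumes "finite S" "l \<in> S" "\<And>D. D \<subseteq> S - {l} \<Longrightarrow> f (insert l D) = f D"
  shows "(\<Sum>D\<in>Pow S. (-1) ^ card D * f D) = 0"
proof -
  let ?S = "S - {l}"
  have S: "S = insert l ?S" and fin: "finite ?S" using assms by auto
  have dis: "Pow ?S \<inter> insert l ` Pow ?S = {}" by auto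
  have inj: "inj_on (insert l) (Pow ?S)" by (auto simp: inj_on_def)
  have "(\<Sum>D\<in>Pow S. (-1) ^ card D * f D) =
      (\<Sum>D\<in>Pow ?S \<union> insert l ` Pow ?S. (-1) ^ card D * f D)"
    by (metis S Pow_insert)
  also have "\<dots> = (\<Sum>D\<in>Pow ?S. (-1) ^ card D * f D) +
      (\<Sum>D\<in>Pow ?S. (-1) ^ card (insert l D) * f (insert l D))"
    using fin dis inj by (subst sum.union_disjoint) (auto simp: sum.reindex)
  also have "(\<Sum>D\<in>Pow ?S. (-1) ^ card (insert l D) * f (insert l D)) =
      (\<Sum>D\<in>Pow ?S. - ((-1) ^ card D * f D))"
  proof (rule sum.cong)
    fix D assume "D \<in> Pow ?S"
    then have D: "D \<subseteq> ?S" "l \<notin> D" "finite D" using fin finite_subset by auto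
    then show "(-1) ^ card (insert l D) * f (insert l D) = - ((-1) ^ card D * f D)"
      using assms(3)[OF D(1)] by simp
  qed simp
  finally show ?thesis by (simp add: sum_negf)
qed

lemma alternating_sum_Pow_prod:
  fixes g :: "'b \<Rightarrow> int"
  assumes "finite S"
  shows "(\<Sum>D\<in>Pow S. (-1) ^ card D * (\<Prod>x\<in>S - D. g x)) = (\<Prod>x\<in>S. g x - 1)"
  using prod_add[OF assms, of "\<lambda>_. -1" g] by simp

section \<open>The Carlitz action\<close>

abbreviation carlitz_act :: "'a::finite_field poly \<Rightarrow> 'a poly \<Rightarrow> 'a poly" where
  "carlitz_act a x \<equiv> poly (carlitz_poly a) x"

lemma carlitz_act_const: "carlitz_act [:c:] x = smult c x"
  by (simp add: carlitz_poly_def carlitz_def tw_to_poly_def poly_monom)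

lemma carlitz_act_0 [simp]: "carlitz_act 0 x = 0"
  using carlitz_act_const[of 0] by simp

lemma carlitz_act_1 [simp]: "carlitz_act 1 x = x"
  by (simp only: one_pCons carlitz_act_const smult_1_left)

context
  fixes p e :: nat and X :: "'a::finite_field itself"
  assumes p: "prime p" "odd p" and card: "CARD('a) = p ^ e"
begin

lemmas carlitz_act_add = poly_carlitz_poly_add[OF p(1) card]
lemmas carlitz_act_mult = poly_carlitz_poly_mult[OF p(1) card]
lemmas carlitz_act_T = poly_carlitz_poly_T[OF p(1) card]

lemma carlitz_act_diff: "carlitz_act (a - b) x = carlitz_act a x - carlitz_act (b :: 'a poly) x"
  using carlitz_act_add[of "a - b" b x] by simp

lemma odd_CARD: "odd CARD('a)"
  using card p by simp

lemma CARD_ge_3: "CARD('a) \<ge> 3"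
proof -
  have "card {0, 1 :: 'a} \<le> CARD('a)" by (rule card_mono) auto
  then have "CARD('a) \<ge> 2" by simp
  moreover have "CARD('a) \<noteq> 2" using odd_CARD by (metis dvd_refl)
  ultimately show ?thesis by simp
qed

lemma carlitz_act_pCons:
  "carlitz_act (pCons c a) x =
     smult c x + [:0, 1:] * carlitz_act a x + carlitz_act a x ^ CARD('a)" for x :: "'a poly"
proof -
  have "pCons c a = [:c:] + [:0, 1:] * a" by simp
  then show ?thesis
    by (simp only: carlitz_act_add carlitz_act_mult carlitz_act_const carlitz_act_T add.assoc)
qed

lemma carlitz_act_expand: "\<exists>h. carlitz_act a x = x * (a + x ^ 2 * h)" for x :: "'a poly"
proof (induction a)
  case 0
  show ?case by (intro exI[of _ 0]) simp
next
  case (pCons c a)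
  then obtain h where h: "carlitz_act a x = x * (a + x ^ 2 * h)" by blast
  define q where "q = CARD('a) - 3"
  have q: "CARD('a) = 3 + q" unfolding q_def using CARD_ge_3 by simp
  have "carlitz_act (pCons c a) x =
      x * (pCons c a + x ^ 2 * ([:0, 1:] * h + x ^ q * (a + x ^ 2 * h) ^ (3 + q)))"
  proof -
    have "(x * (a + x ^ 2 * h)) ^ (3 + q) = x * x ^ 2 * (x ^ q * (a + x ^ 2 * h) ^ (3 + q))"
      by (simp add: power_mult_distrib power_add power2_eq_square power3_eq_cube)
    moreover have "pCons c a = [:c:] + [:0, 1:] * a" by simp
    moreover have "smult c x = [:c:] * x" by simp
    ultimately show ?thesis
      unfolding carlitz_act_pCons h q by (simp only: ring_distribs mult_ac add_ac)
  qed
  then show ?case by blast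
qed

lemma dvd_carlitz_act: "P dvd x \<Longrightarrow> P dvd carlitz_act a (x :: 'a poly)"
  using carlitz_act_expand[of a x] by auto

lemma poly_val_carlitz_act:
  fixes P x b :: "'a poly"
  assumes "prime_elem P" "x \<noteq> 0" "P dvd x" "\<not> P ^ 2 dvd b"
  shows "poly_val P (carlitz_act b x) = poly_val P x + (if P dvd b then 1 else 0)"
proof -
  obtain h where h: "carlitz_act b x = x * (b + x ^ 2 * h)" using carlitz_act_expand by blast
  obtain y where y: "x = P * y" using assms(3) by auto
  have "\<not> P ^ 2 dvd b + x ^ 2 * h"
    using assms(4) unfolding y power_mult_distrib mult.assoc by (simp add: dvd_add_left_iff)
  then have "b + x ^ 2 * h \<noteq> 0" by auto
  then have "poly_val P (carlitz_act b x) = poly_val P x + poly_val P (b + x ^ 2 * h)"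
    using h poly_val_mult assms by simp
  moreover have "poly_val P (b + x ^ 2 * h) = (if P dvd b then 1 else 0)"
  proof (cases "P dvd b")
    case False
    then have "\<not> P dvd b + x ^ 2 * h"
      unfolding y power2_eq_square mult.assoc by (simp add: dvd_add_left_iff)
    then show ?thesis using False poly_val_eq_0 assms(1) by auto
  next
    case True
    then obtain b' where b': "b = P * b'" by auto
    then have eq: "b + x ^ 2 * h = P ^ 1 * (b' + P * (y ^ 2 * h))"
      unfolding y by (simp add: power2_eq_square algebra_simps)
    have "\<not> P dvd b'" using assms(4) b' by (auto simp: power2_eq_square)
    then have "\<not> P dvd b' + P * (y ^ 2 * h)" by (simp add: dvd_add_left_iff)
    then have "poly_val P (b + x ^ 2 * h) = 1"
      unfolding eq by (rule poly_val_eqI[OF assms(1)])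
    then show ?thesis using True by simp
  qed
  ultimately show ?thesis by simp
qed

text \<open>Pigeonhole on the values at the polynomials of degree at most \<open>degree P\<close>.\<close>

lemma carlitz_annihilator_exists:
  fixes P u :: "'a poly"
  assumes "degree P > 0"
  obtains n where "n \<noteq> 0" "degree n \<le> degree P" "P dvd carlitz_act n u"
proof -
  let ?B = "\<lambda>n. {a :: 'a poly. \<forall>i\<ge>n. coeff a i = 0}"
  let ?f = "\<lambda>a. carlitz_act a u mod P"
  have "?f ` ?B (Suc (degree P)) \<subseteq> ?B (degree P)"
  proof (intro subsetI CollectI allI impI)
    fix b i assume "b \<in> ?f ` ?B (Suc (degree P))" "degree P \<le> i"
    moreover from this have "b = 0 \<or> degree b < degree P"
      using assms degree_mod_less[of P] by (metis (no_types, lifting) degree_0 image_iff less_irrefl)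
    ultimately show "coeff b i = 0" by (auto intro: coeff_eq_0)
  qed
  moreover have "CARD('a) ^ degree P < CARD('a) ^ Suc (degree P)"
    using CARD_ge_3 by (intro power_strict_increasing) auto
  ultimately have "\<not> inj_on ?f (?B (Suc (degree P)))"
    using card_inj_on_le[of ?f "?B (Suc (degree P))" "?B (degree P)"]
      card_poly_degree_less[of "degree P", where 'a = 'a]
      card_poly_degree_less[of "Suc (degree P)", where 'a = 'a] by auto
  then obtain a b where ab: "a \<in> ?B (Suc (degree P))" "b \<in> ?B (Suc (degree P))" "a \<noteq> b" "?f a = ?f b"
    by (auto simp: inj_on_def)
  show ?thesis
  proof (rule that)
    show "a - b \<noteq> 0" using ab by simp
    show "degree (a - b) \<le> degree P" using ab by (intro degree_le) auto
    show "P dvd carlitz_act (a - b) u"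
      unfolding carlitz_act_diff using ab(4) by (simp add: mod_eq_dvd_iff)
  qed
qed

lemma carlitz_order_exists:
  fixes P u :: "'a poly"
  assumes "degree P > 0"
  obtains n where "n \<noteq> 0" "degree n \<le> degree P" "\<And>a. P dvd carlitz_act a u \<longleftrightarrow> n dvd a"
proof -
  define R where "R = (\<lambda>n. n \<noteq> 0 \<and> P dvd carlitz_act n u)"
  obtain n0 where n0: "R n0" "degree n0 \<le> degree P"
    using carlitz_annihilator_exists[OF assms] R_def by metis
  obtain n where n: "R n" "\<And>b. R b \<Longrightarrow> degree n \<le> degree b"
    using ex_has_least_nat[of R n0 degree] n0(1) by auto
  show ?thesis
  proof (rule that)
    show "n \<noteq> 0" using n R_def by simp
    show "degree n \<le> degree P" using n(2)[OF n0(1)] n0(2) by simp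
    fix a
    have mult: "P dvd carlitz_act (k * n) u" for k
      using n(1) unfolding R_def carlitz_act_mult by (blast intro: dvd_carlitz_act)
    show "P dvd carlitz_act a u \<longleftrightarrow> n dvd a"
    proof
      assume a: "P dvd carlitz_act a u"
      have "a mod n = a - a div n * n" by (simp add: minus_div_mult_eq_mod)
      then have "P dvd carlitz_act (a mod n) u" using a mult by (simp add: carlitz_act_diff)
      moreover have "a mod n = 0 \<or> degree (a mod n) < degree n"
        using \<open>n \<noteq> 0\<close> by (rule degree_mod_less)
      ultimately have "a mod n = 0" using n(2)[of "a mod n"] unfolding R_def by (meson not_le)
      then show "n dvd a" by auto
    next
      assume "n dvd a"
      then show "P dvd carlitz_act a u" using mult by (auto simp: mult.commute[of n])
    qed
  qed
qed

lemma degree_carlitz_T_act: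
  fixes x :: "'a poly"
  assumes "degree x > 0" "degree y \<le> degree x"
  shows "degree (y + [:0, 1:] * x + x ^ CARD('a)) = CARD('a) * degree x"
proof -
  have x: "x \<noteq> 0" using assms(1) by auto
  have "3 * degree x \<le> CARD('a) * degree x" using CARD_ge_3 by (intro mult_right_mono) auto
  moreover have "degree ([:0, 1:] * x) = Suc (degree x)" using x by simp
  ultimately have "degree ([:0, 1:] * x) < CARD('a) * degree x" "degree y < CARD('a) * degree x"
    using assms by linarith+
  then have "degree (y + [:0, 1:] * x) < CARD('a) * degree x"
    using degree_add_less by blast
  then show ?thesis using x by (simp add: degree_add_eq_right degree_power_eq)
qed

lemma degree_carlitz_act:
  fixes u a :: "'a poly"
  assumes "degree u > 0" "a \<noteq> 0"
  shows "degree (carlitz_act a u) = CARD('a) ^ degree a * degree u"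
  using assms(2)
proof (induction a)
  case (pCons c a)
  show ?case
  proof (cases "a = 0")
    case True
    then show ?thesis using pCons by (simp add: carlitz_act_const)
  next
    case False
    then have IH: "degree (carlitz_act a u) = CARD('a) ^ degree a * degree u" using pCons by simp
    have "degree (smult c u) \<le> degree u" by (rule degree_smult_le)
    also have "\<dots> \<le> degree (carlitz_act a u)" unfolding IH by simp
    finally have "degree (carlitz_act (pCons c a) u) = CARD('a) * degree (carlitz_act a u)"
      unfolding carlitz_act_pCons using assms(1) IH by (intro degree_carlitz_T_act) auto
    then show ?thesis using IH False by simp
  qed
qed simp

lemma degree_carlitz_act_1:
  fixes a :: "'a poly"
  assumes "degree a > 0"
  shows "CARD('a) * degree (carlitz_act a 1) = CARD('a) ^ degree a"
  using assms
proof (induction a)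
  case (pCons c a)
  show ?case
  proof (cases "degree a = 0")
    case True
    then obtain b where b: "a = [:b:]" by (auto elim: degree_eq_zeroE)
    then have "b \<noteq> 0" using pCons by auto
    have "b ^ CARD('a) = b" by (rule finite_field_power_card_eq_same)
    then have "[:b:] ^ CARD('a) = [:b:]" by (simp add: poly_const_pow)
    then have "carlitz_act (pCons c a) 1 = [:c + b, b:]"
      unfolding b carlitz_act_pCons[of c "[:b:]"] carlitz_act_const by simp
    then show ?thesis using b \<open>b \<noteq> 0\<close> by simp
  next
    case False
    then have IH: "CARD('a) * degree (carlitz_act a 1) = CARD('a) ^ degree a" using pCons by auto
    then have "degree (carlitz_act a 1) > 0" using zero_less_iff_neq_zero by fastforce
    then have "degree (carlitz_act (pCons c a) 1) = CARD('a) * degree (carlitz_act a 1)"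
      unfolding carlitz_act_pCons by (intro degree_carlitz_T_act) auto
    then show ?thesis using IH False by auto
  qed
qed simp

lemma carlitz_act_nonzero:
  fixes u a :: "'a poly"
  assumes "lead_coeff u = 1" "a \<noteq> 0"
  shows "carlitz_act a u \<noteq> 0"
proof (cases "degree u > 0")
  case True
  then show ?thesis using degree_carlitz_act[OF True assms(2)] by fastforce
next
  case False
  then have u: "u = 1" using assms(1) by (metis degree_eq_zeroE gr0I lead_coeff_pCons(2) one_pCons)
  show ?thesis
  proof (cases "degree a > 0")
    case True
    then show ?thesis using degree_carlitz_act_1[OF True] u by fastforce
  next
    case False
    then obtain b where "a = [:b:]" by (auto elim: degree_eq_zeroE)
    then show ?thesis using u assms(2) by (simp add: carlitz_act_const)
  qed
qed

section \<open>Extremal primes\<close>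

definition extremal_primes :: "'a poly \<Rightarrow> 'a poly \<Rightarrow> 'a poly set" where
  "extremal_primes u m =
     {P. {l \<in> monic_prime_divisors m. P dvd carlitz_act (m div l) u} = {P}}"

lemma poly_val_carlitz_act_div_prod:
  fixes u m P :: "'a poly"
  assumes "lead_coeff u = 1" "m \<noteq> 0" "D \<subseteq> monic_prime_divisors m"
    and P: "prime_elem P" "lead_coeff P = 1" "P dvd carlitz_act (m div \<Prod>D) u"
  shows "poly_val P (carlitz_act m u) =
    poly_val P (carlitz_act (m div \<Prod>D) u) + (if P \<in> D then 1 else 0)"
proof -
  have fin: "finite (monic_prime_divisors m)" using assms(2) by (rule finite_monic_prime_divisors)
  then have D: "finite D" "\<And>l. l \<in> D \<Longrightarrow> prime_elem l \<and> lead_coeff l = 1"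
    using assms(3) finite_subset by (auto simp: monic_prime_divisors_def)
  have m: "\<Prod>D * (m div \<Prod>D) = m" using div_prod_mult[OF fin assms(3)] by (simp add: mult.commute)
  then have "carlitz_act (m div \<Prod>D) u \<noteq> 0"
    using assms(1,2) by (metis carlitz_act_nonzero mult_zero_right)
  then have "poly_val P (carlitz_act (\<Prod>D) (carlitz_act (m div \<Prod>D) u)) =
    poly_val P (carlitz_act (m div \<Prod>D) u) + (if P dvd \<Prod>D then 1 else 0)"
    using P not_square_dvd_prod_monic_primes[OF D P(1,2)] by (intro poly_val_carlitz_act) auto
  moreover have "P dvd \<Prod>D \<longleftrightarrow> P \<in> D"
    by (rule prime_dvd_prod_monic_primes_iff[OF D P(1,2)])
  ultimately show ?thesis by (simp flip: carlitz_act_mult add: m)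
qed

lemma alternating_sum_poly_val:
  fixes u m P :: "'a poly"
  assumes "lead_coeff u = 1" "m \<noteq> 0"
    and P: "prime_elem P" "lead_coeff P = 1" "P dvd carlitz_act m u"
    and not_zsigmondy: "\<not> zsigmondy_prime u m P"
  shows "(\<Sum>D\<in>Pow (monic_prime_divisors m).
      (-1) ^ card D * int (poly_val P (carlitz_act (m div \<Prod>D) u))) =
    (if P \<in> extremal_primes u m then 1 else 0)"
proof -
  define S where "S = monic_prime_divisors m"
  have fin: "finite S" unfolding S_def using assms(2) by (rule finite_monic_prime_divisors)
  obtain n where n: "n \<noteq> 0" "\<And>a. P dvd carlitz_act a u \<longleftrightarrow> n dvd a"
    using carlitz_order_exists prime_elem_poly_degree_pos[OF P(1)] by metis
  have "n dvd m" using n P by blast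
  then obtain t where t: "m = n * t" by auto
  obtain b where "b \<noteq> 0" "degree b < degree m" "n dvd b"
    using not_zsigmondy P n(2) unfolding zsigmondy_prime_def by (auto simp: cong_0_iff)
  then have "degree n < degree m" using dvd_imp_degree_le by (metis le_less_trans)
  then have "t \<noteq> 0" "degree t > 0" using t assms(2) by (auto simp: degree_mult_eq)
  then obtain l0 where l0: "prime_elem l0" "lead_coeff l0 = 1" "l0 dvd t"
    using monic_prime_divisor_exists by blast
  then have "l0 \<in> S" "n dvd m div l0"
    using t by (auto simp: S_def monic_prime_divisors_def div_mult_swap[symmetric])
  define S' where "S' = {l \<in> S. P dvd carlitz_act (m div l) u}"
  have "l0 \<in> S'" unfolding S'_def n using \<open>l0 \<in> S\<close> \<open>n dvd m div l0\<close> by simp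
  define f where "f = (\<lambda>D. int (poly_val P (carlitz_act (m div \<Prod>D) u)))"
  define v where "v = int (poly_val P (carlitz_act m u))"
  have f: "f D = (if D \<subseteq> S' then v - (if P \<in> D then 1 else 0) else 0)" if D: "D \<subseteq> S" for D
  proof -
    have "P dvd carlitz_act (m div \<Prod>D) u \<longleftrightarrow> D \<subseteq> S'"
      using dvd_div_prod_iff[of m D n] assms(2) fin D \<open>n dvd m\<close> n(2)
      unfolding S_def S'_def by auto
    then show ?thesis
      using poly_val_carlitz_act_div_prod[OF assms(1,2) _ P(1,2), of D] D
      by (auto simp: f_def v_def S_def poly_val_eq_0[OF P(1)])
  qed
  have "(\<Sum>D\<in>Pow S. (-1) ^ card D * f D) = (if S' = {P} then 1 else 0)"
  proof (cases "S' = {P}")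
    case True
    then have "P \<in> S" by (auto simp: S'_def)
    have "(\<Sum>D\<in>Pow S. (-1) ^ card D * f D) = (\<Sum>D\<in>{{}, {P}}. (-1) ^ card D * f D)"
      using fin \<open>P \<in> S\<close> True f by (intro sum.mono_neutral_right) auto
    also have "\<dots> = 1" using f True \<open>P \<in> S\<close> by simp
    finally show ?thesis using True by simp
  next
    case False
    then obtain l where l: "l \<in> S'" "l \<noteq> P" using \<open>l0 \<in> S'\<close> by blast
    then have "l \<in> S" by (simp add: S'_def)
    moreover have "f (insert l D) = f D" if "D \<subseteq> S - {l}" for D
    proof -
      have "insert l D \<subseteq> S" "D \<subseteq> S" using that \<open>l \<in> S\<close> by auto
      then show ?thesis using l f[of D] f[of "insert l D"] by simp
    qed
    ultimately have "(\<Sum>D\<in>Pow S. (-1) ^ card D * f D) = 0"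
      by (rule alternating_sum_Pow_eq_0[OF fin])
    then show ?thesis using False by simp
  qed
  moreover have "P \<in> extremal_primes u m \<longleftrightarrow> S' = {P}"
    by (simp add: extremal_primes_def S'_def S_def)
  ultimately show ?thesis by (simp add: f_def S_def)
qed

lemma extremal_prime:
  assumes "P \<in> extremal_primes u m"
  shows "P \<in> monic_prime_divisors m" "prime_elem P" "lead_coeff P = 1" "P dvd m"
    "P dvd carlitz_act (m div P) u" "P dvd carlitz_act m u"
proof -
  show *: "P \<in> monic_prime_divisors m" "P dvd carlitz_act (m div P) u"
    using assms by (auto simp: extremal_primes_def)
  then show "prime_elem P" "lead_coeff P = 1" "P dvd m" by (auto simp: monic_prime_divisors_def)
  then have "m = P * (m div P)" by simp
  then show "P dvd carlitz_act m u" using dvd_carlitz_act[OF *(2), of P] carlitz_act_mult by metis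
qed

lemma alternating_sum_degree:
  fixes u m :: "'a poly"
  assumes "lead_coeff u = 1" "m \<noteq> 0"
    and not_zsigmondy: "\<And>P. \<not> zsigmondy_prime u m P"
  shows "(\<Sum>D\<in>Pow (monic_prime_divisors m). (-1) ^ card D * int (degree (carlitz_act (m div \<Prod>D) u))) =
    int (\<Sum>P\<in>extremal_primes u m. degree P)"
proof -
  define S where "S = monic_prime_divisors m"
  define I where "I = monic_prime_divisors (carlitz_act m u)"
  have fin: "finite S" unfolding S_def using assms(2) by (rule finite_monic_prime_divisors)
  have finI: "finite I" unfolding I_def
    using assms carlitz_act_nonzero by (intro finite_monic_prime_divisors) auto
  have deg: "degree (carlitz_act (m div \<Prod>D) u) =
      (\<Sum>P\<in>I. poly_val P (carlitz_act (m div \<Prod>D) u) * degree P)" if "D \<in> Pow S" for D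
  proof (rule degree_eq_sum_poly_val[OF _ finI])
    have m: "\<Prod>D * (m div \<Prod>D) = m"
      using div_prod_mult[of m D] fin that by (simp add: mult.commute S_def)
    then show "carlitz_act (m div \<Prod>D) u \<noteq> 0"
      using assms(1,2) by (metis carlitz_act_nonzero mult_zero_right)
    fix P :: "'a poly" assume "prime_elem P" "lead_coeff P = 1" "P dvd carlitz_act (m div \<Prod>D) u"
    moreover have "carlitz_act m u = carlitz_act (\<Prod>D) (carlitz_act (m div \<Prod>D) u)"
      by (simp flip: carlitz_act_mult add: m)
    ultimately show "P \<in> I" by (simp add: dvd_carlitz_act I_def monic_prime_divisors_def)
  qed (auto simp: I_def monic_prime_divisors_def)
  have "(\<Sum>D\<in>Pow S. (-1) ^ card D * int (degree (carlitz_act (m div \<Prod>D) u))) =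
    (\<Sum>D\<in>Pow S. \<Sum>P\<in>I. (-1) ^ card D * int (poly_val P (carlitz_act (m div \<Prod>D) u)) * int (degree P))"
    by (rule sum.cong) (simp_all add: deg sum_distrib_left mult.assoc)
  also have "\<dots> = (\<Sum>P\<in>I. (\<Sum>D\<in>Pow S. (-1) ^ card D * int (poly_val P (carlitz_act (m div \<Prod>D) u))) *
      int (degree P))"
    by (subst sum.swap) (simp add: sum_distrib_right)
  also have "\<dots> = (\<Sum>P\<in>I. (if P \<in> extremal_primes u m then 1 else 0) * int (degree P))"
    unfolding S_def
    by (rule sum.cong)
      (use alternating_sum_poly_val[OF assms(1,2) _ _ _ not_zsigmondy] in
        \<open>auto simp: I_def monic_prime_divisors_def\<close>)
  also have "\<dots> = (\<Sum>P\<in>extremal_primes u m. int (degree P))"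
    using finI extremal_prime by (intro sum.mono_neutral_cong_right) (auto simp: I_def monic_prime_divisors_def)
  finally show ?thesis by (simp add: S_def)
qed

lemma extremal_prime_order:
  fixes u m :: "'a poly"
  assumes "P \<in> extremal_primes u m" "m \<noteq> 0"
  obtains n where "n \<noteq> 0" "degree n \<le> degree P"
    "\<And>l. l \<in> monic_prime_divisors m \<Longrightarrow> l \<noteq> P \<Longrightarrow> l dvd n \<and> \<not> n dvd m div l"
proof -
  note P = extremal_prime[OF assms(1)]
  obtain n where n: "n \<noteq> 0" "degree n \<le> degree P" "\<And>a. P dvd carlitz_act a u \<longleftrightarrow> n dvd a"
    using carlitz_order_exists prime_elem_poly_degree_pos[OF P(2)] by metis
  have "n dvd m" using n P by blast
  then obtain t where t: "m = n * t" by auto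
  have "l dvd n \<and> \<not> n dvd m div l" if l: "l \<in> monic_prime_divisors m" "l \<noteq> P" for l
  proof -
    have not: "\<not> n dvd m div l" using assms(1) l n(3) by (auto simp: extremal_primes_def)
    have "l dvd n"
    proof (rule ccontr)
      assume "\<not> l dvd n"
      then have "l dvd t" using l t by (auto simp: monic_prime_divisors_def prime_elem_dvd_mult_iff)
      then show False using not t by (simp add: div_mult_swap[symmetric])
    qed
    then show ?thesis using not by simp
  qed
  then show ?thesis using that n by blast
qed

lemma two_extremal_primes:
  fixes u m :: "'a poly"
  assumes "lead_coeff m = 1" "P \<in> extremal_primes u m" "Q \<in> extremal_primes u m" "P \<noteq> Q"
  shows "monic_prime_divisors m = {P, Q}" "degree P = degree Q" "m = P * Q"
proof -
  have m: "m \<noteq> 0" using assms(1) by auto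
  have fin: "finite (monic_prime_divisors m)" using m by (rule finite_monic_prime_divisors)
  note P = extremal_prime[OF assms(2)] and Q = extremal_prime[OF assms(3)]
  have *: "degree Q = degree P \<and> (\<forall>l\<in>monic_prime_divisors m. l \<noteq> P \<longrightarrow> l = Q) \<and> \<not> Q dvd m div Q"
    if PQ: "P \<in> extremal_primes u m" "Q \<in> extremal_primes u m" "P \<noteq> Q"
      "degree P \<le> degree Q" for P Q
  proof -
    note P = extremal_prime[OF PQ(1)] and Q = extremal_prime[OF PQ(2)]
    obtain n where n: "n \<noteq> 0" "degree n \<le> degree P"
      "\<And>l. l \<in> monic_prime_divisors m \<Longrightarrow> l \<noteq> P \<Longrightarrow> l dvd n \<and> \<not> n dvd m div l"
      using extremal_prime_order[OF PQ(1) m] by metis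
    then have Qn: "Q dvd n" using Q PQ by blast
    then obtain c where c: "n = Q * c" by auto
    have nz: "Q \<noteq> 0" "c \<noteq> 0" using n c by auto
    then have deg: "degree n = degree Q + degree c" using c by (simp add: degree_mult_eq)
    then have "degree Q = degree P" "degree c = 0" using n(2) PQ(4) by auto
    then have unit: "is_unit c" using nz by (simp add: is_unit_iff_degree)
    have "l = Q" if l: "l \<in> monic_prime_divisors m" "l \<noteq> P" for l
    proof -
      have "l dvd Q * c" using n(3)[OF l] c by simp
      then have "l dvd Q" using unit by (simp add: dvd_mult_unit_iff)
      then show ?thesis using l Q monic_prime_dvd_eq[of l Q] by (auto simp: monic_prime_divisors_def)
    qed
    moreover have "\<not> Q dvd m div Q"
      using n(3)[OF Q(1)] PQ(3) unit c by (simp add: mult_unit_dvd_iff)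
    ultimately show ?thesis using \<open>degree Q = degree P\<close> by blast
  qed
  show deg: "degree P = degree Q"
    using *[OF assms(2,3,4)] *[OF assms(3,2) assms(4)[symmetric]] by linarith
  have PQ: "\<forall>l\<in>monic_prime_divisors m. l \<noteq> P \<longrightarrow> l = Q" "\<not> Q dvd m div Q"
    using *[OF assms(2,3,4)] deg by simp_all
  have QP: "\<not> P dvd m div P"
    using *[OF assms(3,2) assms(4)[symmetric]] deg by simp
  show S: "monic_prime_divisors m = {P, Q}" using PQ(1) P(1) Q(1) by blast
  define w where "w = m div (P * Q)"
  have w: "w * (P * Q) = m"
    using div_prod_mult[OF fin, of "{P, Q}"] S assms(4) by (simp add: w_def)
  have "degree w = 0"
  proof (rule ccontr)
    assume "degree w \<noteq> 0"
    then obtain l where l: "prime_elem l" "lead_coeff l = 1" "l dvd w"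
      using monic_prime_divisor_exists[of w] by (metis degree_0 gr0I)
    then have "l \<in> monic_prime_divisors m" using w by (auto simp: monic_prime_divisors_def)
    then have "P dvd w \<or> Q dvd w" using S l by auto
    moreover have "m div P = w * Q" "m div Q = w * P"
    proof -
      have "m = P * (w * Q)" "m = Q * (w * P)" using w by (metis mult.assoc mult.commute)+
      then show "m div P = w * Q" "m div Q = w * P"
        using P(2) Q(2) by (metis nonzero_mult_div_cancel_left prime_elem_def)+
    qed
    ultimately show False using PQ(2) QP by auto
  qed
  then obtain b where "w = [:b:]" by (auto elim: degree_eq_zeroE)
  then have "m = smult b (P * Q)" using w by simp
  moreover from this have "b = 1"
    using assms(1) P(3) Q(3) by (simp only: lead_coeff_smult lead_coeff_mult mult_1_right)
  ultimately show "m = P * Q" by simp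
qed

section \<open>Comparison of degrees\<close>

text \<open>The order of \<open>(A/m)\<^sup>\<times>\<close>; the exponent is the degree of \<open>m\<close> divided by its radical.\<close>

definition poly_totient :: "'a poly \<Rightarrow> int" where
  "poly_totient m = int CARD('a) ^ degree (m div \<Prod>(monic_prime_divisors m)) *
     (\<Prod>l\<in>monic_prime_divisors m. int CARD('a) ^ degree l - 1)"

lemma alternating_sum_power:
  fixes m :: "'a poly"
  assumes "m \<noteq> 0"
  shows "(\<Sum>D\<in>Pow (monic_prime_divisors m). (-1) ^ card D * int CARD('a) ^ degree (m div \<Prod>D)) =
    poly_totient m"
proof -
  define S where "S = monic_prime_divisors m"
  have fin: "finite S" unfolding S_def using assms by (rule finite_monic_prime_divisors)
  have "(\<Sum>D\<in>Pow S. (-1) ^ card D * int CARD('a) ^ degree (m div \<Prod>D)) =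
    (\<Sum>D\<in>Pow S. int CARD('a) ^ degree (m div \<Prod>S) *
       ((-1) ^ card D * (\<Prod>l\<in>S - D. int CARD('a) ^ degree l)))"
  proof (rule sum.cong)
    fix D assume "D \<in> Pow S"
    then have "degree (m div \<Prod>D) = degree (m div \<Prod>S) + (\<Sum>l\<in>S - D. degree l)"
      using degree_div_prod[OF assms, of D] fin by (simp add: S_def)
    then show "(-1) ^ card D * int CARD('a) ^ degree (m div \<Prod>D) =
        int CARD('a) ^ degree (m div \<Prod>S) * ((-1) ^ card D * (\<Prod>l\<in>S - D. int CARD('a) ^ degree l))"
      by (simp only: power_add power_sum mult_ac)
  qed simp
  also have "\<dots> = int CARD('a) ^ degree (m div \<Prod>S) * (\<Prod>l\<in>S. int CARD('a) ^ degree l - 1)"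
    by (simp add: alternating_sum_Pow_prod[OF fin] flip: sum_distrib_left)
  finally show ?thesis by (simp add: S_def poly_totient_def)
qed

lemma power_CARD_ge: "2 * int d + 1 \<le> int CARD('a) ^ d"
proof (induction d)
  case (Suc d)
  have "3 * (2 * int d + 1) \<le> int CARD('a) * int CARD('a) ^ d"
    using Suc CARD_ge_3 by (intro mult_mono) auto
  then show ?case by simp
qed simp

lemma poly_totient_ge:
  fixes m :: "'a poly"
  assumes "m \<noteq> 0" "T \<subseteq> monic_prime_divisors m"
  shows "int CARD('a) ^ degree (m div \<Prod>(monic_prime_divisors m)) *
    (\<Prod>l\<in>T. int CARD('a) ^ degree l - 1) \<le> poly_totient m"
proof -
  define S where "S = monic_prime_divisors m"
  have fin: "finite S" unfolding S_def using assms(1) by (rule finite_monic_prime_divisors)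
  have ge1: "1 \<le> int CARD('a) ^ degree l - 1" if "l \<in> S" for l
    using power_CARD_ge[of "degree l"] prime_elem_poly_degree_pos[of l] that
    by (auto simp: S_def monic_prime_divisors_def)
  have "1 \<le> (\<Prod>l\<in>S - T. int CARD('a) ^ degree l - 1)"
    using ge1 by (intro prod_ge_1) auto
  moreover have "0 \<le> (\<Prod>l\<in>T. int CARD('a) ^ degree l - 1)"
    by (intro prod_nonneg) simp
  ultimately have "1 * (\<Prod>l\<in>T. int CARD('a) ^ degree l - 1) \<le>
      (\<Prod>l\<in>S - T. int CARD('a) ^ degree l - 1) * (\<Prod>l\<in>T. int CARD('a) ^ degree l - 1)"
    by (rule mult_right_mono)
  also have "\<dots> = (\<Prod>l\<in>S. int CARD('a) ^ degree l - 1)"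
    using fin assms(2) by (intro prod.subset_diff[symmetric]) (auto simp: S_def)
  finally have "(\<Prod>l\<in>T. int CARD('a) ^ degree l - 1) \<le> (\<Prod>l\<in>S. int CARD('a) ^ degree l - 1)"
    by simp
  then show ?thesis unfolding poly_totient_def S_def by (intro mult_left_mono) auto
qed

lemma poly_totient_ge_prod:
  fixes m :: "'a poly"
  assumes "m \<noteq> 0" "T \<subseteq> monic_prime_divisors m"
  shows "(\<Prod>l\<in>T. int CARD('a) ^ degree l - 1) \<le> poly_totient m"
proof -
  have "1 * (\<Prod>l\<in>T. int CARD('a) ^ degree l - 1) \<le>
    int CARD('a) ^ degree (m div \<Prod>(monic_prime_divisors m)) *
    (\<Prod>l\<in>T. int CARD('a) ^ degree l - 1)"
    by (intro mult_right_mono prod_nonneg) auto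
  then show ?thesis using poly_totient_ge[OF assms] by simp
qed

lemma poly_totient_pos: "m \<noteq> 0 \<Longrightarrow> poly_totient m \<ge> 1"
  using poly_totient_ge_prod[of m "{}"] by simp

lemma extremal_primes_cases:
  fixes u m :: "'a poly"
  assumes "lead_coeff m = 1"
  obtains (none) "extremal_primes u m = {}"
  | (one) P where "extremal_primes u m = {P}" "P \<in> extremal_primes u m"
  | (two) P Q where "P \<in> extremal_primes u m" "P \<noteq> Q" "monic_prime_divisors m = {P, Q}"
      "degree P = degree Q" "m = P * Q" "(\<Sum>P\<in>extremal_primes u m. degree P) \<le> 2 * degree P"
proof -
  have m: "m \<noteq> 0" using assms by auto
  show ?thesis
  proof (cases "\<exists>P Q. P \<in> extremal_primes u m \<and> Q \<in> extremal_primes u m \<and> P \<noteq> Q")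
    case True
    then obtain P Q where PQ: "P \<in> extremal_primes u m" "Q \<in> extremal_primes u m" "P \<noteq> Q" by blast
    note two = two_extremal_primes[OF assms PQ]
    have "extremal_primes u m \<subseteq> {P, Q}" using extremal_prime(1) two(1) by blast
    then have "(\<Sum>P\<in>extremal_primes u m. degree P) \<le> (\<Sum>P\<in>{P, Q}. degree P)"
      by (intro sum_mono2) auto
    then have "(\<Sum>P\<in>extremal_primes u m. degree P) \<le> 2 * degree P" using PQ(3) two(2) by simp
    then show ?thesis using that(3) PQ two by blast
  next
    case False
    then show ?thesis using that(1,2) by blast
  qed
qed

lemma zsigmondy_prime_exists_of_degree_pos:
  fixes u m :: "'a poly"
  assumes "lead_coeff u = 1" "lead_coeff m = 1" "degree u > 0"
  shows "\<exists>P. zsigmondy_prime u m P"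
proof (rule ccontr)
  assume "\<not> ?thesis"
  then have no: "\<And>P. \<not> zsigmondy_prime u m P" by blast
  have m: "m \<noteq> 0" using assms(2) by auto
  define S where "S = monic_prime_divisors m"
  have fin: "finite S" unfolding S_def using m by (rule finite_monic_prime_divisors)
  have "degree (carlitz_act (m div \<Prod>D) u) = CARD('a) ^ degree (m div \<Prod>D) * degree u"
    if "D \<in> Pow S" for D
  proof (rule degree_carlitz_act[OF assms(3)])
    have "m div \<Prod>D * \<Prod>D = m" using div_prod_mult[of m D] that fin by (simp add: S_def)
    then show "m div \<Prod>D \<noteq> 0" using m by fastforce
  qed
  then have "(\<Sum>D\<in>Pow S. (-1) ^ card D * int (degree (carlitz_act (m div \<Prod>D) u))) =
    (\<Sum>D\<in>Pow S. ((-1) ^ card D * int CARD('a) ^ degree (m div \<Prod>D)) * int (degree u))"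
    by (intro sum.cong) simp_all
  also have "\<dots> = poly_totient m * int (degree u)"
    using alternating_sum_power[OF m] by (simp add: S_def flip: sum_distrib_right)
  finally have eq: "int (\<Sum>P\<in>extremal_primes u m. degree P) = poly_totient m * int (degree u)"
    using alternating_sum_degree[OF assms(1) m no] by (simp add: S_def)
  have "poly_totient m * 1 \<le> poly_totient m * int (degree u)"
    using assms(3) poly_totient_pos[OF m] by (intro mult_left_mono) auto
  then have le: "poly_totient m \<le> int (\<Sum>P\<in>extremal_primes u m. degree P)" using eq by simp
  from assms(2) show False
  proof (cases rule: extremal_primes_cases[where u = u])
    case none
    then show False using le poly_totient_pos[OF m] by simp
  next
    case (one P)
    note P = extremal_prime[OF one(2)]
    have "2 * int (degree P) \<le> poly_totient m"
      using poly_totient_ge_prod[OF m, of "{P}"] P(1) power_CARD_ge[of "degree P"] by simp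
    then show False using le one prime_elem_poly_degree_pos[OF P(2)] by simp
  next
    case (two P Q)
    have d: "degree P > 0" using extremal_prime[OF two(1)] prime_elem_poly_degree_pos by blast
    have ge: "2 * int (degree P) \<le> int CARD('a) ^ degree P - 1"
      using power_CARD_ge[of "degree P"] by simp
    have "2 * (2 * int (degree P)) \<le> (int CARD('a) ^ degree P - 1) * (int CARD('a) ^ degree P - 1)"
      using ge d by (intro mult_mono) auto
    also have "\<dots> \<le> poly_totient m"
      using poly_totient_ge_prod[OF m, of "{P, Q}"] two by simp
    finally show False using le two(6) d by linarith
  qed
qed

lemma CARD_eq_3_of_small:
  assumes "d > 0" "(int CARD('a) ^ d - 1) * (int CARD('a) - 1) \<le> 2 * int CARD('a) * int d + 1"
  shows "d = 1" "CARD('a) = 3"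
proof -
  define q where "q = int CARD('a)"
  have q: "q \<ge> 3" using CARD_ge_3 by (simp add: q_def)
  show d: "d = 1"
  proof (rule ccontr)
    assume "d \<noteq> 1"
    then obtain c where c: "d = Suc c" "c \<ge> 1" using assms(1) by (cases d) auto
    have "q * (2 * int c + 1) \<le> q * q ^ c"
      using power_CARD_ge[of c] q by (intro mult_left_mono) (auto simp: q_def)
    then have le: "q * (2 * int c + 1) - 1 \<le> q ^ d - 1" using c by simp
    have "1 \<le> q ^ d" using q by (intro one_le_power) auto
    then have "(q * (2 * int c + 1) - 1) * 2 \<le> (q ^ d - 1) * (q - 1)"
      using q by (intro mult_mono le) auto
    also have "\<dots> \<le> 2 * q * (int c + 1) + 1"
      using assms(2) c by (simp add: q_def add.commute)
    finally have "2 * (q * int c) \<le> 3" by (simp add: algebra_simps)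
    moreover have "3 * 1 \<le> q * int c" using q c by (intro mult_mono) auto
    ultimately show False by simp
  qed
  have "q * q \<le> q * 4" using assms(2) unfolding d q_def by (simp add: algebra_simps)
  then have "q \<le> 4" using q by simp
  moreover have "CARD('a) \<noteq> 4" using odd_CARD by auto
  ultimately show "CARD('a) = 3" using q by (simp add: q_def)
qed

lemma exceptional_of_no_zsigmondy_prime:
  fixes m :: "'a poly"
  assumes "lead_coeff m = 1" "degree m > 0" and no: "\<And>P. \<not> zsigmondy_prime 1 m P"
  shows "CARD('a) = 3 \<and>
    (\<exists>P w. lead_coeff P = 1 \<and> degree P = 1 \<and> lead_coeff w = 1 \<and> degree w = 1 \<and> P \<noteq> w \<and> m = P * w)"
proof -
  define q where "q = int CARD('a)"
  have q3: "q \<ge> 3" using CARD_ge_3 by (simp add: q_def)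
  have m: "m \<noteq> 0" using assms(1) by auto
  define S where "S = monic_prime_divisors m"
  have fin: "finite S" unfolding S_def using m by (rule finite_monic_prime_divisors)
  have S: "prime_elem l" "lead_coeff l = 1" "degree l > 0" if "l \<in> S" for l
    using that prime_elem_poly_degree_pos[of l] by (auto simp: S_def monic_prime_divisors_def)
  define sf where "sf \<longleftrightarrow> degree (m div \<Prod>S) = 0"
  define \<epsilon> :: int where "\<epsilon> = (if sf then (-1) ^ card S else 0)"
  have deg: "q * int (degree (carlitz_act (m div \<Prod>D) 1)) =
      q ^ degree (m div \<Prod>D) - (if D = S then if sf then 1 else 0 else 0)" if D: "D \<in> Pow S" for D
  proof (cases "degree (m div \<Prod>D) = 0")
    case True
    have "degree (m div \<Prod>D) = degree (m div \<Prod>S) + (\<Sum>l\<in>S - D. degree l)"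
      using degree_div_prod[OF m, of D] D fin by (simp add: S_def)
    then have "sf" "(\<Sum>l\<in>S - D. degree l) = 0" using True by (simp_all add: sf_def)
    then have "\<forall>l\<in>S - D. degree l = 0" using fin by simp
    then have "S - D = {}" using S(3) by (metis DiffD1 ex_in_conv less_irrefl)
    then have "D = S" using D by auto
    obtain b where "m div \<Prod>D = [:b:]" using True by (auto elim: degree_eq_zeroE)
    then show ?thesis using \<open>sf\<close> \<open>D = S\<close> by (simp add: carlitz_act_const)
  next
    case False
    then have "D = S \<Longrightarrow> \<not> sf" by (auto simp: sf_def)
    moreover have "CARD('a) * degree (carlitz_act (m div \<Prod>D) 1) = CARD('a) ^ degree (m div \<Prod>D)"
      using degree_carlitz_act_1[of "m div \<Prod>D"] False by simp
    then have "q * int (degree (carlitz_act (m div \<Prod>D) 1)) = q ^ degree (m div \<Prod>D)"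
      unfolding q_def by (simp only: flip: of_nat_mult of_nat_power)
    ultimately show ?thesis by simp
  qed
  have "q * int (\<Sum>P\<in>extremal_primes 1 m. degree P) =
    (\<Sum>D\<in>Pow S. (-1) ^ card D * (q * int (degree (carlitz_act (m div \<Prod>D) 1))))"
    unfolding S_def alternating_sum_degree[OF lead_coeff_1 m no, symmetric] sum_distrib_left
    by (rule sum.cong) (simp_all add: mult_ac)
  also have "\<dots> = (\<Sum>D\<in>Pow S. (-1) ^ card D * q ^ degree (m div \<Prod>D) -
      (if D = S then \<epsilon> else 0))"
  proof (rule sum.cong)
    fix D assume D: "D \<in> Pow S"
    show "(-1) ^ card D * (q * int (degree (carlitz_act (m div \<Prod>D) 1))) =
        (-1) ^ card D * q ^ degree (m div \<Prod>D) - (if D = S then \<epsilon> else 0)"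
      unfolding deg[OF D] \<epsilon>_def by (simp add: right_diff_distrib)
  qed simp
  also have "\<dots> = poly_totient m - \<epsilon>"
    using alternating_sum_power[OF m] fin by (simp add: sum_subtractf S_def q_def)
  finally have eq: "q * int (\<Sum>P\<in>extremal_primes 1 m. degree P) = poly_totient m - \<epsilon>" .
  have eps: "\<epsilon> \<le> 1" unfolding \<epsilon>_def by (simp add: minus_one_power_iff)
  have ge: "(q ^ degree P - 1) * (q - 1) \<le> poly_totient m" if P: "P \<in> S" "l \<in> S" "l \<noteq> P" for P l
  proof -
    have "q - 1 \<le> q ^ degree l - 1"
      using self_le_power[of q "degree l"] S(3)[OF P(2)] q3 by simp
    moreover have "0 \<le> q ^ degree P - 1" using one_le_power[of q] q3 by simp
    ultimately have "(q ^ degree P - 1) * (q - 1) \<le> (q ^ degree P - 1) * (q ^ degree l - 1)"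
      by (rule mult_left_mono)
    also have "\<dots> \<le> poly_totient m"
      using poly_totient_ge_prod[OF m, of "{P, l}"] P by (simp add: S_def q_def)
    finally show ?thesis .
  qed
  from assms(1) show ?thesis
  proof (cases rule: extremal_primes_cases[where u = 1])
    case none
    obtain l where l: "l \<in> S"
      using monic_prime_divisor_exists[OF m assms(2)] unfolding S_def monic_prime_divisors_def by blast
    have "2 * int (degree l) \<le> poly_totient m"
      using poly_totient_ge_prod[OF m, of "{l}"] l power_CARD_ge[of "degree l"] by (simp add: S_def)
    moreover have "poly_totient m = \<epsilon>" using eq unfolding none by simp
    ultimately show ?thesis using eps S(3)[OF l] by linarith
  next
    case (one P)
    note P = extremal_prime[OF one(2)]
    have PS: "P \<in> S" using P(1) by (simp add: S_def)
    have eqP: "q * int (degree P) = poly_totient m - \<epsilon>" using eq one by simp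
    have sf
    proof (rule ccontr)
      assume "\<not> sf"
      then have "q * (2 * int (degree P)) \<le> q ^ degree (m div \<Prod>S) * (q ^ degree P - 1)"
        using power_CARD_ge[of "degree P"] q3 self_le_power[of q "degree (m div \<Prod>S)"]
        by (intro mult_mono) (auto simp: sf_def q_def)
      also have "\<dots> \<le> poly_totient m"
        using poly_totient_ge[OF m, of "{P}"] PS by (simp add: S_def q_def)
      finally have "q * (2 * int (degree P)) \<le> q * int (degree P)"
        using eqP \<open>\<not> sf\<close> by (simp add: \<epsilon>_def)
      then show False using q3 S(3)[OF PS] by simp
    qed
    obtain b where b: "m div \<Prod>S = [:b:]" using \<open>sf\<close> by (auto simp: sf_def elim: degree_eq_zeroE)
    define w where "w = \<Prod>(S - {P})"
    have "m div \<Prod>S * \<Prod>S = m" using div_prod_mult[of m S] fin by (simp add: S_def)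
    moreover have "\<Prod>S = P * w" unfolding w_def using PS fin by (simp add: prod.remove)
    ultimately have mw: "m = smult b (P * w)" using b by simp
    have lw: "lead_coeff w = 1" unfolding w_def using S(2) by (simp add: lead_coeff_prod)
    then have "b = 1" using assms(1) P(3) mw by (simp only: lead_coeff_smult lead_coeff_mult mult_1_right)
    then have mPw: "m = P * w" using mw by simp
    have nu: "\<not> P dvd 1" using P(2) by (simp add: prime_elem_def)
    have "S \<noteq> {P}"
    proof
      assume "S = {P}"
      then have "m div P = 1" using mPw P(2) by (auto simp: w_def)
      then show False using P(5) nu by simp
    qed
    then obtain l where l: "l \<in> S" "l \<noteq> P" using PS by blast
    have "(q ^ degree P - 1) * (q - 1) \<le> q * int (degree P) + 1"
      using ge[OF PS l] eqP eps by simp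
    also have "\<dots> \<le> 2 * q * int (degree P) + 1" using q3 by simp
    finally have dq: "degree P = 1" "CARD('a) = 3"
      using CARD_eq_3_of_small[of "degree P"] S(3)[OF PS] by (simp_all add: q_def)
    obtain n where n: "n \<noteq> 0" "degree n \<le> degree P"
      "\<And>l. l \<in> monic_prime_divisors m \<Longrightarrow> l \<noteq> P \<Longrightarrow> l dvd n \<and> \<not> n dvd m div l"
      using extremal_prime_order[OF one(2) m] by metis
    have "w dvd n" unfolding w_def
      using n(3) fin S by (intro prod_monic_primes_dvd) (auto simp: S_def)
    then have "degree w \<le> 1" using n dq dvd_imp_degree_le[of w n] by simp
    moreover have "l dvd w" using l fin unfolding w_def by (intro dvd_prod_eqI[of _ l]) auto
    then have "degree l \<le> degree w" using lw by (intro dvd_imp_degree_le) auto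
    ultimately have "degree w = 1" using S(3)[OF l(1)] by simp
    moreover have "P \<noteq> w"
    proof
      assume "P = w"
      then have "P dvd \<Prod>(S - {P})" by (simp add: w_def)
      then show False using prime_dvd_prod_monic_primes_iff[of "S - {P}" P] fin S P(2,3) by auto
    qed
    ultimately show ?thesis using mPw lw P(3) dq by blast
  next
    case (two P Q)
    then have PQ: "P \<in> S" "Q \<in> S" by (auto simp: S_def)
    have "int (\<Sum>P\<in>extremal_primes 1 m. degree P) \<le> 2 * int (degree P)"
      using two(6) by linarith
    then have "q * int (\<Sum>P\<in>extremal_primes 1 m. degree P) \<le> q * (2 * int (degree P))"
      using q3 by (intro mult_left_mono) auto
    then have "(q ^ degree P - 1) * (q - 1) \<le> 2 * q * int (degree P) + 1"
      using ge[OF PQ] two(2) eq eps by simp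
    then have dP: "degree P = 1" and card3: "CARD('a) = 3"
      using CARD_eq_3_of_small[of "degree P"] S(3)[OF PQ(1)] by (simp_all add: q_def)
    then have "degree Q = 1" using two(4) by simp
    then show ?thesis using dP card3 S(2)[OF PQ(1)] S(2)[OF PQ(2)] two(2,5) by blast
  qed
qed

lemma no_zsigmondy_prime_of_exceptional:
  fixes Q :: "'a poly"
  assumes "CARD('a) = 3" "lead_coeff Q = 1" "degree Q = 1"
  shows "\<not> zsigmondy_prime 1 ((Q - 1) * Q) P"
proof
  assume z: "zsigmondy_prime 1 ((Q - 1) * Q) P"
  obtain c where Q: "Q = [:c, 1:]" using monic_linearE assms(2,3) by blast
  have act: "carlitz_act [:b, 1:] x = [:b, 1:] * x + x ^ 3" for b and x :: "'a poly"
    using carlitz_act_pCons[of b "[:1:]" x] assms(1) by (simp add: carlitz_act_const)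
  have Q1: "Q - 1 = [:c - 1, 1:]" unfolding Q by (simp add: one_pCons)
  have "carlitz_act Q 1 = Q + 1" unfolding Q act by simp
  moreover from this have "carlitz_act (Q - 1) 1 = Q" by (simp add: carlitz_act_diff)
  moreover have "carlitz_act ((Q - 1) * Q) 1 = Q * Q * (Q + 1)"
  proof -
    have "carlitz_act ((Q - 1) * Q) 1 = carlitz_act Q (carlitz_act (Q - 1) 1)"
      by (metis carlitz_act_mult mult.commute)
    also have "\<dots> = Q * Q + Q ^ 3" unfolding \<open>carlitz_act (Q - 1) 1 = Q\<close> by (simp add: act Q)
    finally show ?thesis by (simp add: power3_eq_cube algebra_simps)
  qed
  ultimately have "P dvd carlitz_act (Q - 1) 1 \<or> P dvd carlitz_act Q 1"
    using z by (auto simp: zsigmondy_prime_def cong_0_iff prime_elem_dvd_mult_iff)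
  moreover have "degree (Q - 1) = 1" "degree Q = 1" "Q \<noteq> 0" "Q - 1 \<noteq> 0" unfolding Q1 by (simp_all add: Q)
  moreover from this have "degree ((Q - 1) * Q) = 2" by (simp add: degree_mult_eq)
  ultimately show False using z by (auto simp: zsigmondy_prime_def cong_0_iff)
qed

end

lemma nonzero_eq_1_or_minus_1:
  assumes "CARD('a::finite_field) = 3" "c \<noteq> (0 :: 'a)"
  shows "c = 1 \<or> c = -1"
proof -
  have "c ^ 3 = c" using finite_field_power_card_eq_same[of c] assms(1) by simp
  then have "c * ((c - 1) * (c + 1)) = 0" by (simp add: power3_eq_cube algebra_simps)
  then show ?thesis using assms(2) by (auto simp: eq_neg_iff_add_eq_0)
qed

theorem theorem4p4:
  fixes p e :: nat and m u :: "'a::finite_field poly"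
  assumes "prime p" and "odd p" and "CARD('a) = p ^ e"
    and "lead_coeff m = 1" and "lead_coeff u = 1"
    and "degree m > 0 \<or> degree u > 0"
  shows "(\<exists>P. zsigmondy_prime u m P) \<longleftrightarrow>
     \<not> (CARD('a) = 3 \<and> u = 1 \<and>
        (\<exists>Q. lead_coeff Q = 1 \<and> prime_elem Q \<and> degree Q = 1 \<and> m = (Q - 1) * Q))"
proof (cases "degree u > 0")
  case True
  then show ?thesis
    using zsigmondy_prime_exists_of_degree_pos[OF assms(1-3,5,4)] by auto
next
  case False
  then have u: "u = 1"
    using assms(5) by (metis degree_eq_zeroE gr0I lead_coeff_pCons(2) one_pCons)
  show ?thesis
  proof (cases "\<exists>P. zsigmondy_prime u m P")
    case True
    then show ?thesis
      using no_zsigmondy_prime_of_exceptional[OF assms(1-3)] u by auto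
  next
    case no: False
    obtain P w where *: "CARD('a) = 3" "lead_coeff P = 1" "degree P = 1" "lead_coeff w = 1"
      "degree w = 1" "P \<noteq> w" "m = P * w"
      using exceptional_of_no_zsigmondy_prime[OF assms(1-4)] no False assms(6) u by auto
    obtain a b where ab: "P = [:a, 1:]" "w = [:b, 1:]"
      using monic_linearE *(2-5) by metis
    then have "a - b = 1 \<or> a - b = -1"
      using *(6) nonzero_eq_1_or_minus_1[OF *(1), of "a - b"] by simp
    then have "w = P - 1 \<or> P = w - 1"
      unfolding ab by (auto simp: one_pCons algebra_simps)
    moreover have "prime_elem P" "prime_elem w"
      unfolding ab by (simp_all add: prime_elem_linear_field_poly)
    ultimately have "\<exists>Q. lead_coeff Q = 1 \<and> prime_elem Q \<and> degree Q = 1 \<and> m = (Q - 1) * Q"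
      using *(2-5,7) mult.commute[of P w] by blast
    then show ?thesis using no *(1) u by simp
  qed
qed

end
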